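(* For all integers $i\le1$, all $j,k\in\mathbb Z$ and all $1\le s,t\le p$, we have $\dim_F e_s\Upsilon^{ijk}e_t\le1$.
   Context: $F$ is an algebraically closed field of characteristic $p>0$. $\Psi$ is the $F$-algebra generated by orthogonal idempotents $e_1,\dots,e_p$ summing to $1$ and $x=\sum_{l=2}^pe_{l-1}xe_l$, $\xi=\sum_{l=2}^pe_{l-1}\xi e_l$, subject to $x\xi=\xi x$, $\xi^2=0$; $x$ has $(j,k)$-degree $(-1,1)$ and $\xi$ has $(1,0)$; it is a dg algebra with zero differential, $k$ the homological grading. $\Psi^0=\bigoplus Fe_l$, $\Psi^*$ the graded dual bimodule (degrees negated), $\langle n\rangle$ a shift by $n$ in the $j$-grading ($(M\langle n\rangle)_j=M_{j-n}$). $\sigma$ exchanges $e_l$ and $e_{p+1-l}$ in $\Psi^0$ and $\Psi^\sigma$ is $\Psi$ with right $\Psi^0$-action twisted by $\sigma$. $\maltese=\Psi^\sigma\otimes_{\Psi^0}\Psi^*\langle1\rangle$ and $\maltese^{-1}=\Psi^\sigma\otimes_{\Psi^0}\Psi\langle-1\rangle$ are dg $\Psi$-$\Psi$-bimodules (gradings induced from $\Psi$) with differential $d(a\otimes b)=(-1)^{|a|_k}(ax\otimes\xi b+a\xi\otimes xb)$. Define the trigraded $\Psi$-$\Psi$-bimodule $\Upsilon=\bigoplus\Upsilon^{ijk}$ by $\Upsilon^{i\bullet\bullet}=H(\maltese^{\otimes_\Psi i})$ for $i\ge1$, $\Upsilon^{0\bullet\bullet}=\Psi$, $\Upsilon^{i\bullet\bullet}=H((\maltese^{-1})^{\otimes_\Psi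 -i})$ for $i\le-1$ ($H$ = homology), with $j,k$ the induced gradings. *)

theory Defs
  imports "HOL-Computational_Algebra.Polynomial" "HOL-Library.Function_Algebras"
begin

text \<open>A basis element (r,a,b) of Psi stands for the monomial e_(r-a-b) x^a xi^b e_r
  (x = sum e_(l-1) x e_l, xi = sum e_(l-1) xi e_l, x xi = xi x, xi^2 = 0).
  These monomials, with b <= 1 and 1 <= r-a-b, r <= p, form an F-basis of Psi.\<close>

type_synonym pb = "nat \<times> nat \<times> nat"

definition PB :: "nat \<Rightarrow> pb set" where
  "PB p = {(r,a,b). b \<le> 1 \<and> a + b + 1 \<le> r \<and> r \<le> p}"

definition pb_li :: "pb \<Rightarrow> nat" where "pb_li = (\<lambda>(r,a,b). r - a - b)"
definition pb_ri :: "pb \<Rightarrow> nat" where "pb_ri = (\<lambda>(r,a,b). r)"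
definition pb_j :: "pb \<Rightarrow> int" where "pb_j = (\<lambda>(r,a,b). int b - int a)"
definition pb_k :: "pb \<Rightarrow> int" where "pb_k = (\<lambda>(r,a,b). int a)"

text \<open>Product of two basis monomials (None means the product is zero).\<close>
definition pb_mult :: "pb \<Rightarrow> pb \<Rightarrow> pb option" where
  "pb_mult = (\<lambda>(r1,a1,b1) (r2,a2,b2).
      if r1 = r2 - a2 - b2 \<and> b1 + b2 \<le> 1 then Some (r2, a1 + a2, b1 + b2) else None)"

text \<open>Elements of Psi as coefficient functions on the basis.\<close>
definition ind :: "'x \<Rightarrow> 'x \<Rightarrow> 'f::field" where
  "ind y = (\<lambda>z. if z = y then 1 else 0)"

definition x_el :: "nat \<Rightarrow> pb \<Rightarrow> 'f::field" where
  "x_el p = (\<lambda>\<psi>. if \<psi> \<in> {(r,1,0) | r. 2 \<le> r \<and> r \<le> p} then 1 else 0)"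
definition xi_el :: "nat \<Rightarrow> pb \<Rightarrow> 'f::field" where
  "xi_el p = (\<lambda>\<psi>. if \<psi> \<in> {(r,0,1) | r. 2 \<le> r \<and> r \<le> p} then 1 else 0)"

definition lmul :: "nat \<Rightarrow> (pb \<Rightarrow> 'f::field) \<Rightarrow> pb \<Rightarrow> pb \<Rightarrow> 'f" where
  "lmul p c \<alpha> = (\<lambda>\<gamma>. \<Sum>\<psi>\<in>PB p. c \<psi> * (if pb_mult \<psi> \<alpha> = Some \<gamma> then 1 else 0))"
definition rmul :: "nat \<Rightarrow> pb \<Rightarrow> (pb \<Rightarrow> 'f::field) \<Rightarrow> pb \<Rightarrow> 'f" where
  "rmul p \<alpha> c = (\<lambda>\<gamma>. \<Sum>\<psi>\<in>PB p. c \<psi> * (if pb_mult \<alpha> \<psi> = Some \<gamma> then 1 else 0))"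

text \<open>Graded dual Psi^*: basis element beta stands for the dual basis vector beta^*,
  with (c f)(y) = f(y c) and (f c)(y) = f(c y). The coefficient of gamma^* in c beta^*
  is beta^*(gamma c).\<close>
definition lmul_dual :: "nat \<Rightarrow> (pb \<Rightarrow> 'f::field) \<Rightarrow> pb \<Rightarrow> pb \<Rightarrow> 'f" where
  "lmul_dual p c \<beta> = (\<lambda>\<gamma>. if \<gamma> \<in> PB p then
      (\<Sum>\<psi>\<in>PB p. c \<psi> * (if pb_mult \<gamma> \<psi> = Some \<beta> then 1 else 0)) else 0)"
definition rmul_dual :: "nat \<Rightarrow> pb \<Rightarrow> (pb \<Rightarrow> 'f::field) \<Rightarrow> pb \<Rightarrow> 'f" where
  "rmul_dual p \<beta> c = (\<lambda>\<gamma>. if \<gamma> \<in> PB p then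
      (\<Sum>\<psi>\<in>PB p. c \<psi> * (if pb_mult \<psi> \<gamma> = Some \<beta> then 1 else 0)) else 0)"

record ('b,'f) bimod =
  bas :: "'b set"
  li :: "'b \<Rightarrow> nat"        \<comment> \<open>left idempotent index\<close>
  ri :: "'b \<Rightarrow> nat"        \<comment> \<open>right idempotent index\<close>
  jd :: "'b \<Rightarrow> int"
  kd :: "'b \<Rightarrow> int"
  lact :: "pb \<Rightarrow> 'b \<Rightarrow> 'b \<Rightarrow> 'f"
  ract :: "'b \<Rightarrow> pb \<Rightarrow> 'b \<Rightarrow> 'f"
  dg :: "'b \<Rightarrow> 'b \<Rightarrow> 'f"

definition psiM :: "nat \<Rightarrow> (pb, 'f::field) bimod" where
  "psiM p = \<lparr> bas = PB p, li = pb_li, ri = pb_ri, jd = pb_j, kd = pb_k,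
     lact = (\<lambda>\<psi> \<alpha>. lmul p (ind \<psi>) \<alpha>), ract = (\<lambda>\<alpha> \<psi>. rmul p \<alpha> (ind \<psi>)),
     dg = (\<lambda>\<alpha>. 0) \<rparr>"

text \<open>sigma(l) = p + 1 - l. In Psi^sigma (x)_{Psi^0} N, the pair a (x) n survives iff
  the right idempotent of a is sigma of the left idempotent of n.\<close>
definition pairc :: "(pb \<Rightarrow> bool) \<Rightarrow> (pb \<Rightarrow> 'f::field) \<Rightarrow> (pb \<Rightarrow> 'f) \<Rightarrow> pb \<times> pb \<Rightarrow> 'f" where
  "pairc ok c1 c2 = (\<lambda>(\<gamma>,\<delta>). if ok \<gamma> \<and> ok \<delta> then c1 \<gamma> * c2 \<delta> else 0)"

definition ksign :: "int \<Rightarrow> 'f::field" where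
  "ksign n = (if even n then 1 else -1)"

text \<open>maltese^{-1} = Psi^sigma (x)_{Psi^0} Psi <-1>; basis pair (alpha,beta) = alpha (x) beta.\<close>
definition maltinvM :: "nat \<Rightarrow> (pb \<times> pb, 'f::field) bimod" where
  "maltinvM p = \<lparr> bas = {(\<alpha>,\<beta>). \<alpha> \<in> PB p \<and> \<beta> \<in> PB p \<and> pb_ri \<alpha> + pb_li \<beta> = p + 1},
     li = (\<lambda>(\<alpha>,\<beta>). pb_li \<alpha>), ri = (\<lambda>(\<alpha>,\<beta>). pb_ri \<beta>),
     jd = (\<lambda>(\<alpha>,\<beta>). pb_j \<alpha> + pb_j \<beta> - 1), kd = (\<lambda>(\<alpha>,\<beta>). pb_k \<alpha> + pb_k \<beta>),
     lact = (\<lambda>\<psi> (\<alpha>,\<beta>). (\<lambda>(\<gamma>,\<delta>). if pb_ri \<gamma> + pb_li \<delta> = p + 1 then lmul p (ind \<psi>) \<alpha> \<gamma> * ind \<beta> \<delta> else 0)),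
     ract = (\<lambda>(\<alpha>,\<beta>) \<psi>. (\<lambda>(\<gamma>,\<delta>). if pb_ri \<gamma> + pb_li \<delta> = p + 1 then ind \<alpha> \<gamma> * rmul p \<beta> (ind \<psi>) \<delta> else 0)),
     dg = (\<lambda>(\<alpha>,\<beta>). (\<lambda>(\<gamma>,\<delta>). if pb_ri \<gamma> + pb_li \<delta> = p + 1 then
            ksign (pb_k \<alpha>) * (rmul p \<alpha> (x_el p) \<gamma> * lmul p (xi_el p) \<beta> \<delta>
                             + rmul p \<alpha> (xi_el p) \<gamma> * lmul p (x_el p) \<beta> \<delta>) else 0)) \<rparr>"

text \<open>maltese = Psi^sigma (x)_{Psi^0} Psi^* <1>; basis pair (alpha,beta) = alpha (x) beta^*.
  beta^* lies in e_(ri beta) Psi^* e_(li beta) and has degree minus that of beta.\<close>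
definition maltM :: "nat \<Rightarrow> (pb \<times> pb, 'f::field) bimod" where
  "maltM p = \<lparr> bas = {(\<alpha>,\<beta>). \<alpha> \<in> PB p \<and> \<beta> \<in> PB p \<and> pb_ri \<alpha> + pb_ri \<beta> = p + 1},
     li = (\<lambda>(\<alpha>,\<beta>). pb_li \<alpha>), ri = (\<lambda>(\<alpha>,\<beta>). pb_li \<beta>),
     jd = (\<lambda>(\<alpha>,\<beta>). pb_j \<alpha> - pb_j \<beta> + 1), kd = (\<lambda>(\<alpha>,\<beta>). pb_k \<alpha> - pb_k \<beta>),
     lact = (\<lambda>\<psi> (\<alpha>,\<beta>). (\<lambda>(\<gamma>,\<delta>). if pb_ri \<gamma> + pb_ri \<delta> = p + 1 then lmul p (ind \<psi>) \<alpha> \<gamma> * ind \<beta> \<delta> else 0)),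
     ract = (\<lambda>(\<alpha>,\<beta>) \<psi>. (\<lambda>(\<gamma>,\<delta>). if pb_ri \<gamma> + pb_ri \<delta> = p + 1 then ind \<alpha> \<gamma> * rmul_dual p \<beta> (ind \<psi>) \<delta> else 0)),
     dg = (\<lambda>(\<alpha>,\<beta>). (\<lambda>(\<gamma>,\<delta>). if pb_ri \<gamma> + pb_ri \<delta> = p + 1 then
            ksign (pb_k \<alpha>) * (rmul p \<alpha> (x_el p) \<gamma> * lmul_dual p (xi_el p) \<beta> \<delta>
                             + rmul p \<alpha> (xi_el p) \<gamma> * lmul_dual p (x_el p) \<beta> \<delta>) else 0)) \<rparr>"

text \<open>The n-fold tensor power over Psi is realised as V/R, where V is the F-vector space
  with basis the words of length n in basis elements (M (x)_F ... (x)_F M) and R is spanned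
  by the relations m psi (x) n - m (x) psi n at each junction.\<close>

definition fscale :: "'f::field \<Rightarrow> ('x \<Rightarrow> 'f) \<Rightarrow> ('x \<Rightarrow> 'f)" where
  "fscale c v = (\<lambda>w. c * v w)"

abbreviation fspan :: "('x \<Rightarrow> 'f::field) set \<Rightarrow> ('x \<Rightarrow> 'f) set" where
  "fspan \<equiv> module.span fscale"
abbreviation fdim :: "('x \<Rightarrow> 'f::field) set \<Rightarrow> nat" where
  "fdim \<equiv> vector_space.dim fscale"

definition words :: "('b,'f) bimod \<Rightarrow> nat \<Rightarrow> 'b list set" where
  "words M n = {w. length w = n \<and> set w \<subseteq> bas M}"

definition subst_at :: "'b list \<Rightarrow> nat \<Rightarrow> ('b \<Rightarrow> 'f::field) \<Rightarrow> 'b list \<Rightarrow> 'f" where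
  "subst_at w i c = (\<lambda>w'. if length w' = length w \<and> (\<forall>j<length w. j \<noteq> i \<longrightarrow> w' ! j = w ! j)
                            then c (w' ! i) else 0)"

definition rels :: "nat \<Rightarrow> ('b,'f::field) bimod \<Rightarrow> nat \<Rightarrow> ('b list \<Rightarrow> 'f) set" where
  "rels p M n = {subst_at w i (ract M (w ! i) \<psi>) - subst_at w (Suc i) (lact M \<psi> (w ! Suc i)) | w i \<psi>.
                   w \<in> words M n \<and> Suc i < n \<and> \<psi> \<in> PB p}"

text \<open>Koszul rule: d(m1 (x) ... (x) mn) = sum_i (-1)^(|m1|+...+|m_(i-1)|) m1 (x) .. d mi .. (x) mn.\<close>
definition dword :: "('b,'f::field) bimod \<Rightarrow> 'b list \<Rightarrow> 'b list \<Rightarrow> 'f" where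
  "dword M w = (\<Sum>i<length w. fscale (ksign (\<Sum>b\<leftarrow>take i w. kd M b)) (subst_at w i (dg M (w ! i))))"

definition Vsp :: "('b,'f) bimod \<Rightarrow> nat \<Rightarrow> ('b list \<Rightarrow> 'f::field) set" where
  "Vsp M n = {v. \<forall>w. v w \<noteq> 0 \<longrightarrow> w \<in> words M n}"

definition dlin :: "('b,'f::field) bimod \<Rightarrow> nat \<Rightarrow> ('b list \<Rightarrow> 'f) \<Rightarrow> 'b list \<Rightarrow> 'f" where
  "dlin M n v = (\<Sum>w\<in>words M n. fscale (v w) (dword M w))"

definition words_deg :: "('b,'f) bimod \<Rightarrow> nat \<Rightarrow> nat \<Rightarrow> nat \<Rightarrow> int \<Rightarrow> int \<Rightarrow> 'b list set" where
  "words_deg M n s t j k = {w \<in> words M n. w \<noteq> [] \<and> li M (hd w) = s \<and> ri M (last w) = t \<and>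
       (\<Sum>b\<leftarrow>w. jd M b) = j \<and> (\<Sum>b\<leftarrow>w. kd M b) = k}"

text \<open>Dimension of e_s H(M^{(x)n})^{j,k} e_t.  With Q = V/R, the (s,t,j,k)-piece of Q is the
  image of V_deg; the cycles in it are Z/R and the boundaries in it are B/R, where
  Z = {v in V_deg + R. d v in R} and B = (d V + R) \<inter> (V_deg + R), so dim H = dim Z - dim B.\<close>
definition hdim :: "nat \<Rightarrow> ('b,'f::field) bimod \<Rightarrow> nat \<Rightarrow> nat \<Rightarrow> nat \<Rightarrow> int \<Rightarrow> int \<Rightarrow> nat" where
  "hdim p M n s t j k =
    (let R = fspan (rels p M n);
         Vd = {v \<in> Vsp M n. \<forall>w. v w \<noteq> 0 \<longrightarrow> w \<in> words_deg M n s t j k};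
         Qd = fspan (Vd \<union> R);
         Z = {v \<in> Qd. dlin M n v \<in> R};
         B = fspan (dlin M n ` Vsp M n \<union> R) \<inter> Qd
     in fdim Z - fdim B)"

definition upsilon_dim :: "'f::field itself \<Rightarrow> nat \<Rightarrow> int \<Rightarrow> int \<Rightarrow> int \<Rightarrow> nat \<Rightarrow> nat \<Rightarrow> nat" where
  "upsilon_dim F p i j k s t =
    (if i = 0 then hdim p (psiM p :: (pb,'f) bimod) 1 s t j k
     else if i > 0 then hdim p (maltM p :: (pb \<times> pb,'f) bimod) (nat i) s t j k
     else hdim p (maltinvM p :: (pb \<times> pb,'f) bimod) (nat (- i)) s t j k)"

end

theory Submission
  imports Defs "HOL-Library.List_Lexorder"
begin

text \<open>Since Psi is free over itself, the n-fold tensor power of the inverse bimodule is the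
  complex of words alpha_0 ... alpha_n of monomials in which consecutive idempotents are
  exchanged by sigma, with d acting at each junction by x (x) xi + xi (x) x: a zigzag path
  in {1,...,p} whose turning points move outwards. For paths starting at s < p, cancel a word
  alpha_0 alpha_1 ... with alpha_1 free of xi and alpha_0 not reaching p against the word with x
  added to alpha_0 and xi to alpha_1; cancel 1 (x) x^a xi against xi (x) x^(a+1) xi; and recurse
  behind a prefix xi (x) xi. The other words are (xi xi)^m followed by a path that always runs to
  the end of {1,...,p} and carries at most one xi, or by a final piece of length at most one. The
  number of letters xi and the end points determine such a word, so each degree contains at most
  one of them. A path starting at p has alpha_0 = 1 and reduces to one starting at 1.\<close>

section \<open>Linear extension of maps between bases\<close>

text \<open>No homology group is computed: for the bound it is enough that any two cycles of one
  degree have a nontrivial combination that is a boundary modulo the tensor relations. The recursion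
  behind xi (x) xi closes up because these letters return to the start: from s the first ends at s +
  1, which sigma turns into p - s; the second ends at p - s + 1, which sigma turns into s. The
  degree fixes the number of xi: a monomial with b letters xi has j + k = b, so with the shift by -1
  in each factor the n-fold power has j + k + n of them, while k counts the x. Passing from V/R to
  words needs R to be exactly the kernel of the contraction: one inclusion is associativity of Psi,
  the other rewrites every word modulo R into a normal form with units as inner right factors. For i
  = 1 there are no relations, and the cycles of each degree already span at most a line.\<close>

definition lin_ext :: "('x \<Rightarrow> 'y \<Rightarrow> 'f::field) \<Rightarrow> ('x \<Rightarrow> 'f) \<Rightarrow> 'y \<Rightarrow> 'f" where
  "lin_ext f v = (\<lambda>y. \<Sum>x | v x \<noteq> 0. v x * f x y)"

definition fin_supp :: "('x \<Rightarrow> 'f::field) \<Rightarrow> bool" where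
  "fin_supp v \<longleftrightarrow> finite {x. v x \<noteq> 0}"

definition cons_lin :: "'x \<Rightarrow> ('x list \<Rightarrow> 'f::field) \<Rightarrow> 'x list \<Rightarrow> 'f" where
  "cons_lin a v = (\<lambda>w. case w of [] \<Rightarrow> 0 | b # u \<Rightarrow> if b = a then v u else 0)"

lemma sum_fun_app: "(\<Sum>i\<in>A. f i) x = (\<Sum>i\<in>A. f i x :: 'f::field)"
  by (induction A rule: infinite_finite_induct) auto

lemma fin_supp_0 [simp]: "fin_supp 0"
  and fin_supp_ind [simp]: "fin_supp (ind x)"
  by (auto simp: fin_supp_def ind_def)

lemma fin_supp_add [simp]: "fin_supp u \<Longrightarrow> fin_supp v \<Longrightarrow> fin_supp (u + v)"
  unfolding fin_supp_def by (rule finite_subset[of _ "{x. u x \<noteq> 0} \<union> {x. v x \<noteq> 0}"]) auto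

lemma fin_supp_fscale [simp]: "fin_supp v \<Longrightarrow> fin_supp (fscale c v)"
  unfolding fin_supp_def by (rule finite_subset[of _ "{x. v x \<noteq> 0}"]) (auto simp: fscale_def)

lemma cons_lin_nz: "{w. cons_lin a v w \<noteq> 0} = (#) a ` {u. v u \<noteq> 0}"
proof (rule set_eqI)
  show "w \<in> {w. cons_lin a v w \<noteq> 0} \<longleftrightarrow> w \<in> (#) a ` {u. v u \<noteq> 0}" for w
    by (cases w) (auto simp: cons_lin_def)
qed

lemma fin_supp_cons_lin [simp]: "fin_supp v \<Longrightarrow> fin_supp (cons_lin a v)"
  unfolding fin_supp_def by (simp add: cons_lin_nz)

lemma lin_ext_superset:
  assumes "finite A" "{x. v x \<noteq> 0} \<subseteq> A"
  shows "lin_ext f v y = (\<Sum>x\<in>A. v x * f x y)"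
  unfolding lin_ext_def by (rule sum.mono_neutral_left) (use assms in auto)

lemma lin_ext_nz: "{y. lin_ext f v y \<noteq> 0} \<subseteq> (\<Union>x\<in>{x. v x \<noteq> 0}. {y. f x y \<noteq> 0})"
proof
  fix y assume "y \<in> {y. lin_ext f v y \<noteq> 0}"
  then obtain x where "v x \<noteq> 0" "v x * f x y \<noteq> 0"
    unfolding lin_ext_def by (auto elim!: sum.not_neutral_contains_not_neutral)
  then show "y \<in> (\<Union>x\<in>{x. v x \<noteq> 0}. {y. f x y \<noteq> 0})" by auto
qed

lemma fin_supp_lin_ext [simp]:
  assumes "fin_supp v" "\<And>x. fin_supp (f x)"
  shows "fin_supp (lin_ext f v)"
  unfolding fin_supp_def
  by (rule finite_subset[OF lin_ext_nz]) (use assms in \<open>auto simp: fin_supp_def\<close>)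

lemma lin_ext_0 [simp]: "lin_ext f 0 = 0"
  by (auto simp: lin_ext_def)

lemma lin_ext_ind [simp]: "lin_ext f (ind x) = f x"
proof -
  have "lin_ext f (ind x) y = (\<Sum>z\<in>{x}. ind x z * f z y)" for y
    by (rule lin_ext_superset) (auto simp: ind_def)
  then show ?thesis by (auto simp: ind_def)
qed

text \<open>A sum over an infinite support is 0 by convention, hence the finiteness assumptions.
  Scaling does without them, since a nonzero scalar keeps the support.\<close>

lemma lin_ext_add:
  assumes "fin_supp u" "fin_supp v"
  shows "lin_ext f (u + v) = lin_ext f u + lin_ext f v"
proof
  fix y
  let ?A = "{x. u x \<noteq> 0} \<union> {x. v x \<noteq> 0}"
  have "finite ?A" using assms by (simp add: fin_supp_def)
  then have "lin_ext f (u + v) y = (\<Sum>x\<in>?A. (u + v) x * f x y)"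
    "lin_ext f u y = (\<Sum>x\<in>?A. u x * f x y)" "lin_ext f v y = (\<Sum>x\<in>?A. v x * f x y)"
    by (rule lin_ext_superset; auto)+
  then show "lin_ext f (u + v) y = (lin_ext f u + lin_ext f v) y"
    by (simp add: distrib_right sum.distrib)
qed

lemma lin_ext_fscale: "lin_ext f (fscale c v) = fscale c (lin_ext f v)"
proof (cases "c = 0")
  case True
  then show ?thesis by (auto simp: fscale_def lin_ext_def)
next
  case False
  then show ?thesis by (auto simp: fscale_def lin_ext_def sum_distrib_left mult.assoc)
qed

lemma lin_ext_cong: "(\<And>x. v x \<noteq> 0 \<Longrightarrow> f x = g x) \<Longrightarrow> lin_ext f v = lin_ext g v"
  by (auto simp: lin_ext_def intro!: ext sum.cong)

text \<open>The condition on \<open>g\<close> is restricted to the support of \<open>v\<close>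
  because \<open>dword\<close> is only shown to have finite support on words of basis
  elements.\<close>

lemma lin_ext_comp:
  assumes "fin_supp v" "\<And>x. v x \<noteq> 0 \<Longrightarrow> fin_supp (g x)"
  shows "lin_ext f (lin_ext g v) = lin_ext (\<lambda>x. lin_ext f (g x)) v"
proof
  fix y
  let ?V = "{x. v x \<noteq> 0}" and ?A = "\<Union>x\<in>{x. v x \<noteq> 0}. {y. g x y \<noteq> 0}"
  have fV: "finite ?V" using assms by (simp add: fin_supp_def)
  have fA: "finite ?A" using assms by (auto simp: fin_supp_def)
  have "lin_ext f (lin_ext g v) y = (\<Sum>z\<in>?A. lin_ext g v z * f z y)"
    by (rule lin_ext_superset[OF fA lin_ext_nz])
  also have "\<dots> = (\<Sum>x\<in>?V. v x * (\<Sum>z\<in>?A. g x z * f z y))"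
    unfolding lin_ext_def sum_distrib_right sum_distrib_left
    by (subst sum.swap) (simp add: mult.assoc)
  also have "\<dots> = (\<Sum>x\<in>?V. v x * lin_ext f (g x) y)"
  proof (rule sum.cong[OF refl])
    fix x assume "x \<in> ?V"
    then have "{z. g x z \<noteq> 0} \<subseteq> ?A" by auto
    then show "v x * (\<Sum>z\<in>?A. g x z * f z y) = v x * lin_ext f (g x) y"
      by (simp add: lin_ext_superset[OF fA])
  qed
  finally show "lin_ext f (lin_ext g v) y = lin_ext (\<lambda>x. lin_ext f (g x)) v y"
    by (simp add: lin_ext_def)
qed

lemma lin_ext_fun_0 [simp]: "lin_ext (\<lambda>x. 0) v = 0"
  by (auto simp: lin_ext_def)

lemma lin_ext_fun_add: "lin_ext (\<lambda>x. f x + g x) v = lin_ext f v + lin_ext g v"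
  by (auto simp: lin_ext_def distrib_left sum.distrib)

lemma lin_ext_fun_fscale: "lin_ext (\<lambda>x. fscale c (f x)) v = fscale c (lin_ext f v)"
  by (auto simp: lin_ext_def fscale_def sum_distrib_left mult.left_commute)

lemma cons_lin_ind [simp]: "cons_lin a (ind w) = ind (a # w)"
  by (auto simp: cons_lin_def ind_def split: list.splits)

lemma cons_lin_0 [simp]: "cons_lin a 0 = 0"
  by (auto simp: cons_lin_def split: list.splits)

lemma cons_lin_add: "cons_lin a (u + v) = cons_lin a u + cons_lin a v"
  by (auto simp: cons_lin_def split: list.splits)

lemma cons_lin_diff: "cons_lin a (u - v) = cons_lin a u - cons_lin a v"
  by (auto simp: cons_lin_def split: list.splits)

lemma cons_lin_fscale: "cons_lin a (fscale c v) = fscale c (cons_lin a v)"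
  by (auto simp: cons_lin_def fscale_def split: list.splits)

lemma cons_lin_lin_ext: "cons_lin a (lin_ext f v) = lin_ext (\<lambda>x. cons_lin a (f x)) v"
  by (auto simp: cons_lin_def lin_ext_def split: list.splits)

lemma lin_ext_cons_lin: "lin_ext f (cons_lin a v) = lin_ext (\<lambda>w. f (a # w)) v"
proof
  fix y
  have "lin_ext f (cons_lin a v) y = (\<Sum>x\<in>(#) a ` {u. v u \<noteq> 0}. cons_lin a v x * f x y)"
    by (simp add: lin_ext_def cons_lin_nz)
  also have "\<dots> = (\<Sum>u | v u \<noteq> 0. cons_lin a v (a # u) * f (a # u) y)"
    by (subst sum.reindex) auto
  finally show "lin_ext f (cons_lin a v) y = lin_ext (\<lambda>w. f (a # w)) v y"
    by (simp add: lin_ext_def cons_lin_def)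
qed

lemma fscale_fscale [simp]: "fscale c (fscale e v) = fscale (c * e) v"
  by (simp add: fscale_def mult.assoc)

lemma fscale_1 [simp]: "fscale 1 v = v"
  and fscale_0 [simp]: "fscale c 0 = 0"
  and fscale_zero [simp]: "fscale 0 v = 0"
  by (auto simp: fscale_def)

lemma fscale_add: "fscale c (u + v) = fscale c u + fscale c v"
  by (auto simp: fscale_def distrib_left)

lemma ksign_sq [simp]: "ksign a * ksign a = 1"
  and ksign_Suc: "ksign (1 + a) = - ksign a"
  and ksign_add: "ksign (a + b) = ksign a * ksign b"
  and ksign_nz [simp]: "ksign a \<noteq> 0"
  by (auto simp: ksign_def)

section \<open>Cycles of a matched complex\<close>

text \<open>Only the triangularity of the matching with respect to \<^term>\<open>wt\<close> is used: it makes the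
  component of d from the matched sources to the matched targets invertible.\<close>

lemma morse:
  fixes d :: "'c \<Rightarrow> 'c \<Rightarrow> 'f::field" and wt :: "'c \<Rightarrow> 'w::linorder"
  assumes fin: "finite X" "finite Y"
    and sub: "\<And>y x. y \<in> Y \<Longrightarrow> d y x \<noteq> 0 \<Longrightarrow> x \<in> X"
    and dd: "\<And>y c. y \<in> Y \<Longrightarrow> (\<Sum>x\<in>X. d y x * d x c) = 0"
    and m_nz: "\<And>u v. m u v \<Longrightarrow> d u v \<noteq> 0"
    and m_fun: "\<And>u v v'. m u v \<Longrightarrow> m u v' \<Longrightarrow> v = v'"
    and m_tri: "\<And>u v u' v'. m u v \<Longrightarrow> m u' v' \<Longrightarrow> d u v' \<noteq> 0 \<Longrightarrow> u = u' \<or> wt u' < wt u"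
    and crit: "\<And>x x'. x \<in> X \<Longrightarrow> x' \<in> X \<Longrightarrow> \<nexists>v. m x v \<Longrightarrow> \<nexists>v. m x' v \<Longrightarrow>
        \<not> (\<exists>u\<in>Y. m u x) \<Longrightarrow> \<not> (\<exists>u\<in>Y. m u x') \<Longrightarrow> x = x'"
    and z1: "\<And>x. z1 x \<noteq> 0 \<Longrightarrow> x \<in> X" "\<And>c. (\<Sum>x\<in>X. z1 x * d x c) = 0"
    and z2: "\<And>x. z2 x \<noteq> 0 \<Longrightarrow> x \<in> X" "\<And>c. (\<Sum>x\<in>X. z2 x * d x c) = 0"
  shows "\<exists>c1 c2 y. (c1 \<noteq> 0 \<or> c2 \<noteq> 0) \<and> (\<forall>x. c1 * z1 x + c2 * z2 x = (\<Sum>u\<in>Y. y u * d u x))"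
proof -
  define U where "U = {u\<in>Y. \<exists>v. m u v}"
  \<comment> \<open>Triangular elimination in order of weight: the inserted x has the largest
    weight, so no u in A reaches its partner v0. This forces the coefficient z v0 / d x v0 of x, and
    the induction hypothesis solves for the remainder.\<close>
  have elim: "\<exists>y. \<forall>u v. u \<in> A \<longrightarrow> m u v \<longrightarrow> z v = (\<Sum>w\<in>A. y w * d w v)"
    if "finite A" "A \<subseteq> U" for A z
    using that
  proof (induction arbitrary: z rule: finite_ranking_induct[where f = wt])
    case empty
    then show ?case by simp
  next
    case (insert x A)
    show ?case
    proof (cases "x \<in> A")
      case True
      then show ?thesis using insert by (simp add: insert_absorb)
    next
      case xA: False
      obtain v0 where v0: "m x v0" using insert.prems by (auto simp: U_def)
      have other: "d u v0 = 0" if "u \<in> A" for u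
      proof (rule ccontr)
        assume "d u v0 \<noteq> 0"
        moreover have "\<exists>v. m u v" using insert.prems that by (auto simp: U_def)
        ultimately have "u = x \<or> wt x < wt u" using m_tri v0 by blast
        then show False using insert.hyps xA that by (metis leD)
      qed
      define c where "c = z v0 / d x v0"
      obtain y where y: "\<And>u v. u \<in> A \<Longrightarrow> m u v \<Longrightarrow> z v - c * d x v = (\<Sum>w\<in>A. y w * d w v)"
        using insert.IH[of "\<lambda>v. z v - c * d x v"] insert.prems by auto
      show ?thesis
      proof (intro exI[of _ "y(x := c)"] allI impI)
        fix u v assume u: "u \<in> insert x A" "m u v"
        have eq: "(\<Sum>w\<in>insert x A. (y(x := c)) w * d w v) = c * d x v + (\<Sum>w\<in>A. y w * d w v)"
          using insert.hyps xA by (subst sum.insert) (auto intro!: sum.cong)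
        show "z v = (\<Sum>w\<in>insert x A. (y(x := c)) w * d w v)"
        proof (cases "u = x")
          case True
          then have "v = v0" using m_fun u v0 by blast
          then have "(\<Sum>w\<in>A. y w * d w v) = 0" using other by simp
          then show ?thesis using eq m_nz[OF v0] \<open>v = v0\<close> by (simp add: c_def)
        next
          case False
          then have "z v - c * d x v = (\<Sum>w\<in>A. y w * d w v)" using u y by blast
          then show ?thesis using eq by (simp add: algebra_simps)
        qed
    qed
    qed
  qed
  have fU: "finite U" "U \<subseteq> Y" using fin by (auto simp: U_def)
  have red: "\<exists>y. \<forall>u v. u \<in> U \<longrightarrow> m u v \<longrightarrow> z v = (\<Sum>w\<in>Y. y w * d w v)" for z
  proof -
    obtain y where "\<forall>u v. u \<in> U \<longrightarrow> m u v \<longrightarrow> z v = (\<Sum>w\<in>U. y w * d w v)"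
      using elim[OF fU(1), of z] by blast
    moreover have "(\<Sum>w\<in>U. y w * d w v) = (\<Sum>w\<in>Y. (if w \<in> U then y w else 0) * d w v)" for v
      by (rule sum.mono_neutral_cong_left) (use fin fU in auto)
    ultimately show ?thesis by (intro exI[of _ "\<lambda>w. if w \<in> U then y w else 0"]) simp
  qed
  \<comment> \<open>A cycle supported on sources vanishes: for u of maximal weight in the support,
    no other element of the support reaches the partner v of u, so the coefficient of v in the
    boundary would be z u * d u v, which is nonzero.\<close>
  have cyc: "z x = 0" if supp: "\<And>x. z x \<noteq> 0 \<Longrightarrow> x \<in> X \<and> (\<exists>v. m x v)"
    and z: "\<And>c. (\<Sum>x\<in>X. z x * d x c) = 0" for z x
  proof (rule ccontr)
    assume "z x \<noteq> 0"
    let ?S = "{x\<in>X. z x \<noteq> 0}"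
    have "finite ?S" "?S \<noteq> {}" using fin supp \<open>z x \<noteq> 0\<close> by auto
    then have "Max (wt ` ?S) \<in> wt ` ?S" by (intro Max_in) auto
    then obtain u where u: "u \<in> ?S" "wt u = Max (wt ` ?S)" by auto
    have max: "wt u' \<le> wt u" if "u' \<in> ?S" for u'
      using u(2) \<open>finite ?S\<close> that by simp
    obtain v where v: "m u v" using u supp by blast
    have "(\<Sum>x\<in>X. z x * d x v) = (\<Sum>x\<in>{u}. z x * d x v)"
    proof (rule sum.mono_neutral_right)
      show "\<forall>i\<in>X - {u}. z i * d i v = 0"
      proof (safe, rule ccontr)
        fix i assume i: "i \<in> X" "z i * d i v \<noteq> 0" "i \<noteq> u"
        then obtain w where "m i w" using supp by fastforce
        then have "wt u < wt i" using m_tri[OF _ v] i by auto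
        then show False using max i by (metis (mono_tags, lifting) leD mem_Collect_eq mult_zero_left)
      qed
    qed (use fin u in auto)
    then show False using z u m_nz[OF v] by simp
  qed
  obtain y1 where y1: "\<And>u v. u \<in> U \<Longrightarrow> m u v \<Longrightarrow> z1 v = (\<Sum>w\<in>Y. y1 w * d w v)"
    using red[of z1] by blast
  obtain y2 where y2: "\<And>u v. u \<in> U \<Longrightarrow> m u v \<Longrightarrow> z2 v = (\<Sum>w\<in>Y. y2 w * d w v)"
    using red[of z2] by blast
  \<comment> \<open>Subtracting boundaries makes both cycles vanish on all targets of sources in Y;
    they stay cycles because d d = 0.\<close>
  define t1 where "t1 = (\<lambda>x. z1 x - (\<Sum>w\<in>Y. y1 w * d w x))"
  define t2 where "t2 = (\<lambda>x. z2 x - (\<Sum>w\<in>Y. y2 w * d w x))"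
  have bX: "x \<in> X" if "(\<Sum>w\<in>Y. y w * d w x) \<noteq> 0" for y :: "'c \<Rightarrow> 'f" and x
    using that sub by (metis (no_types, lifting) mult_zero_right sum.neutral)
  have bcyc: "(\<Sum>x\<in>X. (\<Sum>w\<in>Y. y w * d w x) * d x c) = 0" for y :: "'c \<Rightarrow> 'f" and c
  proof -
    have "(\<Sum>x\<in>X. (\<Sum>w\<in>Y. y w * d w x) * d x c) = (\<Sum>w\<in>Y. y w * (\<Sum>x\<in>X. d w x * d x c))"
      unfolding sum_distrib_right sum_distrib_left by (subst sum.swap) (simp add: mult.assoc)
    then show ?thesis using dd by simp
  qed
  have t1: "t1 x \<noteq> 0 \<Longrightarrow> x \<in> X" "(\<Sum>x\<in>X. t1 x * d x c) = 0"
    and t2: "t2 x \<noteq> 0 \<Longrightarrow> x \<in> X" "(\<Sum>x\<in>X. t2 x * d x c) = 0" for x c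
    unfolding t1_def t2_def left_diff_distrib sum_subtractf bcyc z1(2) z2(2)
    using z1(1) z2(1) bX by force+
  \<comment> \<open>At most one critical element remains, and a combination of two values can be
    made to vanish there. What is left is supported on sources, so \<open>cyc\<close>
    applies.\<close>
  obtain c1 c2 where c: "c1 \<noteq> 0 \<or> c2 \<noteq> 0"
    and ck: "\<And>x. x \<in> X \<Longrightarrow> \<nexists>v. m x v \<Longrightarrow> \<not> (\<exists>u\<in>Y. m u x) \<Longrightarrow> c1 * t1 x + c2 * t2 x = 0"
  proof (cases "\<exists>x\<in>X. (\<nexists>v. m x v) \<and> \<not> (\<exists>u\<in>Y. m u x) \<and> (t1 x \<noteq> 0 \<or> t2 x \<noteq> 0)")
    case True
    then obtain x where x: "x \<in> X" "\<nexists>v. m x v" "\<not> (\<exists>u\<in>Y. m u x)" "t1 x \<noteq> 0 \<or> t2 x \<noteq> 0" by blast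
    show ?thesis
    proof (rule that[of "t2 x" "- t1 x"])
      show "t2 x * t1 x' + - t1 x * t2 x' = 0"
        if "x' \<in> X" "\<nexists>v. m x' v" "\<not> (\<exists>u\<in>Y. m u x')" for x'
        using crit[OF x(1) that(1) x(2) that(2) x(3) that(3)] by simp
    qed (use x in auto)
  next
    case False
    then show ?thesis by (intro that[of 1 1]) auto
  qed
  define z where "z = (\<lambda>x. c1 * t1 x + c2 * t2 x)"
  have "z x = 0" for x
  proof (rule cyc)
    show "(\<Sum>x\<in>X. z x * d x c) = 0" for c
      using t1(2)[of c] t2(2)[of c]
      by (simp add: z_def distrib_right sum.distrib mult.assoc flip: sum_distrib_left)
    show "x \<in> X \<and> (\<exists>v. m x v)" if nz: "z x \<noteq> 0" for x
    proof
      show "x \<in> X" using nz t1(1) t2(1) unfolding z_def by force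
      show "\<exists>v. m x v"
      proof (rule ccontr)
        assume no: "\<nexists>v. m x v"
        have "\<not> (\<exists>u\<in>Y. m u x)"
        proof safe
          fix u assume "u \<in> Y" "m u x"
          then have "u \<in> U" by (auto simp: U_def)
          then have "t1 x = 0" "t2 x = 0" using y1 y2 \<open>m u x\<close> by (auto simp: t1_def t2_def)
          then show False using nz by (simp add: z_def)
        qed
        then show False using ck \<open>x \<in> X\<close> no nz by (auto simp: z_def)
      qed
    qed
  qed
  then have "\<forall>x. c1 * z1 x + c2 * z2 x = (\<Sum>u\<in>Y. (c1 * y1 u + c2 * y2 u) * d u x)"
    by (auto simp: z_def t1_def t2_def algebra_simps sum.distrib sum_distrib_left)
  with c show ?thesis by (intro exI conjI)
qed

section \<open>The reduced complex\<close>

fun left_x :: "pb list \<Rightarrow> pb list \<Rightarrow> 'f::field" where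
  "left_x [] = 0"
| "left_x ((r,a,b) # w) = ind ((r, Suc a, b) # w)"

fun left_xi :: "pb list \<Rightarrow> pb list \<Rightarrow> 'f::field" where
  "left_xi [] = 0"
| "left_xi ((r,a,b) # w) = (if b = 0 then ind ((r, a, 1) # w) else 0)"

text \<open>The differential induced on words of monomials; \<^term>\<open>left_x\<close> and
  \<^term>\<open>left_xi\<close> multiply the first letter only and, on words whose idempotents match,
  yield a valid monomial exactly when \<^term>\<open>r < p\<close>.\<close>

fun zigzag_d :: "nat \<Rightarrow> pb list \<Rightarrow> pb list \<Rightarrow> 'f::field" where
  "zigzag_d p [] = 0"
| "zigzag_d p ((r,a,b) # w) = fscale (ksign (int a))
     ((if r < p then cons_lin (Suc r, Suc a, b) (left_xi w) + (if b = 0 then cons_lin (Suc r, a, 1) (left_x w) else 0) else 0)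
      + cons_lin (r,a,b) (zigzag_d p w))"

lemma fin_supp_left_x [simp]: "fin_supp (left_x w)" and fin_supp_left_xi [simp]: "fin_supp (left_xi w)"
  by (cases w rule: left_x.cases; simp)+

lemma fin_supp_zigzag_d [simp]: "fin_supp (zigzag_d p w)"
proof (induction w)
  case Nil
  show ?case by (simp only: zigzag_d.simps fin_supp_0)
next
  case (Cons x w)
  then show ?case by (cases x) auto
qed

lemma lin_ext_zigzag_d_cons_lin: "lin_ext (zigzag_d p) (cons_lin (r,a,b) v) = fscale (ksign (int a))
     ((if r < p then cons_lin (Suc r, Suc a, b) (lin_ext left_xi v) + (if b = 0 then cons_lin (Suc r, a, 1) (lin_ext left_x v) else 0) else 0)
      + cons_lin (r,a,b) (lin_ext (zigzag_d p) v))"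
  by (simp add: lin_ext_cons_lin lin_ext_fun_add lin_ext_fun_fscale cons_lin_lin_ext)

lemma left_xi_left_xi: "lin_ext left_xi (left_xi w) = 0"
  by (cases w rule: left_x.cases) auto

lemma left_x_left_xi: "lin_ext left_x (left_xi w) = lin_ext left_xi (left_x w)"
  by (cases w rule: left_x.cases) auto

lemma lin_ext_ind_id: "fin_supp v \<Longrightarrow> lin_ext ind v = v"
proof
  fix y assume "fin_supp v"
  then have fin: "finite (insert y {x. v x \<noteq> 0})" by (simp add: fin_supp_def)
  have "lin_ext ind v y = (\<Sum>x\<in>insert y {x. v x \<noteq> 0}. v x * ind x y)"
    by (rule lin_ext_superset[OF fin]) auto
  also have "\<dots> = (\<Sum>x\<in>{y}. v x * ind x y)"
    by (rule sum.mono_neutral_right[OF fin]) (auto simp: ind_def)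
  finally show "lin_ext ind v y = v y" by (simp add: ind_def)
qed

lemma lin_ext_ind_Cons: "fin_supp v \<Longrightarrow> lin_ext (\<lambda>w. ind (a # w)) v = cons_lin a v"
  using cons_lin_lin_ext[of a ind v] by (simp add: lin_ext_ind_id)

lemma lin_ext_left_x_cons_lin: "fin_supp v \<Longrightarrow> lin_ext left_x (cons_lin (r,a,b) v) = cons_lin (r,Suc a,b) v"
  and lin_ext_left_xi_cons_lin: "fin_supp v \<Longrightarrow> lin_ext left_xi (cons_lin (r,a,b) v) = (if b = 0 then cons_lin (r,a,1) v else 0)"
  by (simp_all add: lin_ext_cons_lin lin_ext_ind_Cons)

text \<open>Only x has odd homological degree, so left multiplication by xi commutes with d and left
  multiplication by x anticommutes.\<close>

lemma lin_ext_left_xi_zigzag_d: "lin_ext left_xi (zigzag_d p w) = lin_ext (zigzag_d p) (left_xi w)"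
proof (cases w rule: left_x.cases)
  case (2 r a b w')
  then show ?thesis
    by (auto simp: lin_ext_fscale lin_ext_add lin_ext_left_xi_cons_lin)
qed simp

lemma lin_ext_left_x_zigzag_d: "lin_ext left_x (zigzag_d p w) = fscale (- 1) (lin_ext (zigzag_d p) (left_x w))"
proof (cases w rule: left_x.cases)
  case (2 r a b w')
  then show ?thesis
    by (auto simp: lin_ext_fscale lin_ext_add lin_ext_left_x_cons_lin ksign_Suc)
qed simp

text \<open>At one junction, x (x) xi and xi (x) x square to zero since xi^2 = 0, and their two
  composites cancel because x changes the sign of the first letter and xi does not. Contributions of
  different junctions cancel by the Koszul rule.\<close>

lemma zigzag_d_zigzag_d: "lin_ext (zigzag_d p) (zigzag_d p w) = (0 :: pb list \<Rightarrow> 'f::field)"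
proof (induction w)
  case (Cons \<alpha> w)
  obtain r a b where \<alpha>: "\<alpha> = (r,a,b)" by (cases \<alpha>)
  have comp: "lin_ext left_xi (lin_ext (zigzag_d p) v) = lin_ext (zigzag_d p) (lin_ext left_xi v)"
     "lin_ext left_x (lin_ext (zigzag_d p) v) = fscale (- 1) (lin_ext (zigzag_d p) (lin_ext left_x v))" if "fin_supp v" for v :: "pb list \<Rightarrow> 'f"
    using that by (simp_all add: lin_ext_comp lin_ext_left_xi_zigzag_d lin_ext_left_x_zigzag_d lin_ext_fun_fscale)
  have IH: "lin_ext (zigzag_d p) (zigzag_d p w) = (0 :: pb list \<Rightarrow> 'f)" by (rule Cons)
  show "lin_ext (zigzag_d p) (zigzag_d p (\<alpha> # w)) = (0 :: pb list \<Rightarrow> 'f)"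
    by (cases "b = 0"; cases "r < p"; cases "Suc r < p";
        simp add: \<alpha> lin_ext_fscale lin_ext_add lin_ext_zigzag_d_cons_lin lin_ext_left_xi_zigzag_d lin_ext_left_x_zigzag_d left_xi_left_xi left_x_left_xi IH
         cons_lin_fscale fscale_add ksign_Suc)
      (auto simp: fscale_def fun_eq_iff)
next
  case Nil
  show "lin_ext (zigzag_d p) (zigzag_d p []) = (0 :: pb list \<Rightarrow> 'f)" by simp
qed

section \<open>The matching on the reduced complex\<close>

text \<open>Contains the support of \<open>zigzag_d\<close> for every field, so that triangularity
  and degree statements become rule inductions without coefficients.\<close>

inductive dstep :: "nat \<Rightarrow> pb list \<Rightarrow> pb list \<Rightarrow> bool" for p where
  dstep_x_xi: "r0 < p \<Longrightarrow> dstep p ((r0,a0,b0) # (r1,a1,0) # w) ((Suc r0,Suc a0,b0) # (r1,a1,1) # w)"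
| dstep_xi_x: "r0 < p \<Longrightarrow> dstep p ((r0,a0,0) # (r1,a1,b1) # w) ((Suc r0,a0,1) # (r1,Suc a1,b1) # w)"
| dstep_Cons: "dstep p w v \<Longrightarrow> dstep p (\<alpha> # w) (\<alpha> # v)"

text \<open>Once a letter reaches p, the junction behind it is rigid, so the cancellation moves on to the next
  junction; the letters behind the first one then carry no xi.\<close>

inductive front_match :: "nat \<Rightarrow> pb list \<Rightarrow> pb list \<Rightarrow> bool" for p where
  front_match_base: "r0 < p \<Longrightarrow> front_match p ((r0,a0,b0) # (r1,a1,0) # w) ((Suc r0,Suc a0,b0) # (r1,a1,1) # w)"
| front_match_rec: "front_match p ((r1,a1,0) # w) v \<Longrightarrow> front_match p ((p,a0,b0) # (r1,a1,0) # w) ((p,a0,b0) # v)"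

inductive cell_match :: "nat \<Rightarrow> pb list \<Rightarrow> pb list \<Rightarrow> bool" for p where
  cell_match_A: "front_match p u v \<Longrightarrow> cell_match p u v"
| cell_match_U: "r0 < p \<Longrightarrow> cell_match p ((r0,0,0) # (r1,a1,1) # w) ((Suc r0,0,1) # (r1,Suc a1,1) # w)"
| cell_match_rec: "cell_match p u v \<Longrightarrow> cell_match p ((r0,0,1) # (r1,0,1) # u) ((r0,0,1) # (r1,0,1) # v)"

text \<open>Ordered lexicographically. If a step from a source u ends in the target of another
  source u', then u' must be smaller. Leading entries 3 and 2 belong to a second letter without xi;
  xi (x) x at the first junction leads from 3 to 2. Entry 1 is the prefix xi (x) xi, behind which
  the comparison continues, and 0 is 1 (x) x^a xi; steps in the tail may lead down to these.
  Otherwise u' undoes an x (x) xi to the left of the step, which lowers the first exponent in which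
  u and u' differ.\<close>

fun match_weight :: "pb list \<Rightarrow> nat list" where
  "match_weight ((r0,a0,b0) # (r1,a1,b1) # w) =
     (if b1 = 0 then (if b0 = 0 then 3 else 2) # a0 # a1 # map (fst \<circ> snd) w
      else if b0 = 0 then [0] else 1 # match_weight w)"
| "match_weight w = []"

lemma cons_lin_Nil [simp]: "cons_lin a f [] = 0" and cons_lin_Cons [simp]: "cons_lin a f (b # w) = (if b = a then f w else 0)"
  by (simp_all add: cons_lin_def)

lemma ind_same [simp]: "ind x x = 1"
  by (simp add: ind_def)

lemma zigzag_d_nz_dstep: "zigzag_d p w v \<noteq> (0 :: 'f::field) \<Longrightarrow> dstep p w v"
proof (induction w arbitrary: v)
  case (Cons \<alpha> w)
  obtain r a b where \<alpha>: "\<alpha> = (r,a,b)" by (cases \<alpha>)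
  obtain \<beta> v' where v: "v = \<beta> # v'"
    using Cons.prems by (cases v) (auto simp: \<alpha> fscale_def split: if_splits)
  consider "r < p" "\<beta> = (Suc r, Suc a, b)" "left_xi w v' \<noteq> (0 :: 'f)"
    | "r < p" "b = 0" "\<beta> = (Suc r, a, 1)" "left_x w v' \<noteq> (0 :: 'f)"
    | "\<beta> = (r,a,b)" "zigzag_d p w v' \<noteq> (0 :: 'f)"
    using Cons.prems unfolding \<alpha> v by (auto simp: fscale_def split: if_splits)
  then show ?case
  proof cases
    case 1
    then show ?thesis unfolding \<alpha> v
      by (cases w rule: left_x.cases) (auto simp: ind_def intro: dstep_x_xi[simplified] split: if_splits)
  next
    case 2
    then show ?thesis unfolding \<alpha> v
      by (cases w rule: left_x.cases) (auto simp: ind_def intro: dstep_xi_x[simplified] split: if_splits)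
  next
    case 3
    then show ?thesis unfolding \<alpha> v using Cons.IH by (auto intro: dstep.intros)
  qed
qed simp

section \<open>Inversion rules, determinacy and triangularity of the matching\<close>

lemma front_match_nz: "front_match p u v \<Longrightarrow> zigzag_d p u v \<noteq> (0 :: 'f::field)"
  by (induction rule: front_match.induct) (auto simp: fscale_def ind_def)

lemma cell_match_nz: "cell_match p u v \<Longrightarrow> zigzag_d p u v \<noteq> (0 :: 'f::field)"
  by (induction rule: cell_match.induct) (auto simp: fscale_def ind_def front_match_nz)

lemma front_match_target_iff: "front_match p u ((r,a,b) # v) \<longleftrightarrow>
    (\<exists>r0 a0 r1 a1 w. r = Suc r0 \<and> a = Suc a0 \<and> r0 < p \<and> v = (r1,a1,1) # w \<and> u = (r0,a0,b) # (r1,a1,0) # w) \<or>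
    (r = p \<and> (\<exists>r1 a1 w. u = (p,a,b) # (r1,a1,0) # w \<and> front_match p ((r1,a1,0) # w) v))"
  by (subst front_match.simps) auto

lemma front_match_source_iff: "front_match p ((r,a,b) # w) v \<longleftrightarrow>
    (\<exists>r1 a1 w'. w = (r1,a1,0) # w' \<and>
      (r < p \<and> v = (Suc r,Suc a,b) # (r1,a1,1) # w' \<or>
       r = p \<and> (\<exists>v'. v = (p,a,b) # v' \<and> front_match p w v')))"
  by (subst front_match.simps) auto

lemma not_front_match [simp]: "\<not> front_match p ((r,a,b) # (r1,a1,Suc b1) # w) v"
  by (subst front_match.simps) auto

lemma front_match_source: "front_match p u v \<Longrightarrow> \<exists>r0 a0 b0 r1 a1 w. u = (r0,a0,b0) # (r1,a1,0) # w"
  by (induction rule: front_match.induct) auto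

lemma front_match_fun: "front_match p u v \<Longrightarrow> front_match p u v' \<Longrightarrow> v = v'"
proof (induction arbitrary: v' rule: front_match.induct)
  case (front_match_base r0 a0 b0 r1 a1 w)
  from front_match_base(2,1) show ?case by cases auto
next
  case (front_match_rec r1 a1 w v a0 b0)
  from front_match_rec(3) show ?case by cases (use front_match_rec(2) in auto)
qed

lemma cell_match_source_iff: "cell_match p ((r0,a0,b0) # (r1,a1,b1) # w) v \<longleftrightarrow>
    front_match p ((r0,a0,b0) # (r1,a1,b1) # w) v \<or>
    (r0 < p \<and> a0 = 0 \<and> b0 = 0 \<and> b1 = 1 \<and> v = (Suc r0,0,1) # (r1,Suc a1,1) # w) \<or>
    (a0 = 0 \<and> b0 = 1 \<and> a1 = 0 \<and> b1 = 1 \<and> (\<exists>v'. v = (r0,0,1) # (r1,0,1) # v' \<and> cell_match p w v'))"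
  by (subst cell_match.simps) auto

lemma cell_match_target_iff: "cell_match p u ((r0,a0,b0) # (r1,a1,b1) # v) \<longleftrightarrow>
    front_match p u ((r0,a0,b0) # (r1,a1,b1) # v) \<or>
    (\<exists>r a. r0 = Suc r \<and> r < p \<and> a0 = 0 \<and> b0 = 1 \<and> a1 = Suc a \<and> b1 = 1 \<and> u = (r,0,0) # (r1,a,1) # v) \<or>
    (a0 = 0 \<and> b0 = 1 \<and> a1 = 0 \<and> b1 = 1 \<and> (\<exists>u'. u = (r0,0,1) # (r1,0,1) # u' \<and> cell_match p u' v))"
  by (subst cell_match.simps) auto

lemma cell_match_fun: "cell_match p u v \<Longrightarrow> cell_match p u v' \<Longrightarrow> v = v'"
proof (induction arbitrary: v' rule: cell_match.induct)
  case (cell_match_A u v)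
  then obtain r0 a0 b0 r1 a1 w where "u = (r0,a0,b0) # (r1,a1,0) # w" using front_match_source by blast
  with cell_match_A show ?case by (auto simp: cell_match_source_iff dest: front_match_fun)
next
  case (cell_match_U r0 r1 a1 w)
  from cell_match_U(2) show ?case by cases auto
next
  case (cell_match_rec u v r0 r1)
  from cell_match_rec(3) show ?case by cases (use cell_match_rec(2) in auto)
qed

lemma front_match_tri:
  "dstep p u v' \<Longrightarrow> front_match p u v \<Longrightarrow> front_match p u' v' \<Longrightarrow> u = u' \<or> match_weight u' < match_weight u"
proof (induction arbitrary: v u' rule: dstep.induct)
  case (dstep_Cons w v1 \<alpha>)
  obtain r a b where \<alpha>: "\<alpha> = (r,a,b)" by (cases \<alpha>)
  then obtain r1 a1 w1 where w: "w = (r1,a1,0) # w1"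
    using front_match_source[OF dstep_Cons.prems(1)] by auto
  consider r0 a0 r1' a1' w' where "r = Suc r0" "a = Suc a0" "u' = (r0,a0,b) # (r1',a1',0) # w'"
    | r1' a1' w' where "r = p" "u' = (p,a,b) # (r1',a1',0) # w'" "front_match p ((r1',a1',0) # w') v1"
    using dstep_Cons.prems(2) unfolding \<alpha> front_match_target_iff by blast
  then show ?case
  proof cases
    case 1
    then show ?thesis by (auto simp: \<alpha> w)
  next
    case 2
    then obtain v2 where "front_match p w v2"
      using dstep_Cons.prems(1) unfolding \<alpha> by (subst (asm) front_match_source_iff) auto
    \<comment> \<open>Both tails are sources with leading entry 3, so comparing their weights means
      comparing their exponent lists, which are also what follows the common first letter in the
      full weights.\<close>
    with dstep_Cons.IH[OF this 2(3)] 2 show ?thesis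
      using front_match_source[OF \<open>front_match p w v2\<close>] front_match_source[OF 2(3)] by (auto simp: \<alpha> w)
  qed
qed (auto simp: front_match_target_iff)

lemma dstep_head_b: "dstep p ((r,a,1) # w) v \<Longrightarrow> \<exists>r' a' v'. v = (r',a',1) # v'"
  by (subst (asm) dstep.simps) auto

lemma cell_match_tri:
  "cell_match p u v \<Longrightarrow> dstep p u v' \<Longrightarrow> cell_match p u' v' \<Longrightarrow> u = u' \<or> match_weight u' < match_weight u"
proof (induction arbitrary: v' u' rule: cell_match.induct)
  case (cell_match_A u v)
  obtain r0 a0 b0 r1 a1 w where u: "u = (r0,a0,b0) # (r1,a1,0) # w"
    using front_match_source[OF cell_match_A(1)] by blast
  from cell_match_A(3) show ?case
  proof cases
    case cell_match_A
    then show ?thesis using front_match_tri \<open>dstep p u v'\<close> \<open>front_match p u v\<close> by blast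
  qed (auto simp: u)
next
  \<comment> \<open>The weight [0] is least among matched words, so here the two sources must
    coincide: no step from this source ends in the target of another one.\<close>
  case (cell_match_U r0 r1 a1 w)
  from cell_match_U(2) show ?case
  proof cases
    case (dstep_Cons v1)
    then obtain r' a' v2 where "v1 = (r',a',1) # v2" using dstep_head_b by blast
    with dstep_Cons cell_match_U show ?thesis by (auto simp: cell_match_target_iff front_match_target_iff)
  qed (use cell_match_U in \<open>auto simp: cell_match_target_iff front_match_target_iff\<close>)
next
  case (cell_match_rec u v r0 r1)
  from cell_match_rec.prems(1) obtain v1 where v1: "v' = (r0,0,1) # v1" "dstep p ((r1,0,1) # u) v1"
    by cases auto
  from v1(2) show ?case
  proof cases
    case (dstep_Cons v2)
    then have "cell_match p ua v2 \<Longrightarrow> u = ua \<or> match_weight ua < match_weight u" for ua using cell_match_rec.IH by blast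
    moreover obtain ua where "u' = (r0,0,1) # (r1,0,1) # ua" "cell_match p ua v2"
      using dstep_Cons v1 cell_match_rec.prems(2) by (auto simp: cell_match_target_iff front_match_target_iff)
    ultimately have "u = ua \<or> match_weight ua < match_weight u" by blast
    then show ?thesis using \<open>u' = _\<close> by auto
  \<comment> \<open>The remaining step is x (x) xi at the second junction. Its result begins with xi
    (x) x xi, which is only a target of \<open>cell_match_U\<close>, and that source has weight
    [0].\<close>
  qed (use v1 cell_match_rec in \<open>auto simp: cell_match_target_iff front_match_target_iff\<close>)
qed

text \<open>Selects the basis words of an iterated tensor product of copies of Psi over Psi^0
  twisted by sigma: a letter starts at the sigma-image of the idempotent where its predecessor
  ended.\<close>

fun zigzag :: "nat \<Rightarrow> nat \<Rightarrow> pb list \<Rightarrow> bool" where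
  "zigzag p l [] \<longleftrightarrow> True"
| "zigzag p l ((r,a,b) # w) \<longleftrightarrow> b \<le> 1 \<and> r = l + a + b \<and> r \<le> p \<and> 1 \<le> l \<and> zigzag p (p + 1 - r) w"

abbreviation x_count :: "pb list \<Rightarrow> nat" where "x_count w \<equiv> \<Sum>\<alpha>\<leftarrow>w. fst (snd \<alpha>)"
abbreviation xi_count :: "pb list \<Rightarrow> nat" where "xi_count w \<equiv> \<Sum>\<alpha>\<leftarrow>w. snd (snd \<alpha>)"

text \<open>The differential inserts one x, of degree (-1,1), and one xi, of degree (1,0); thus j is
  kept and k rises by one.\<close>

definition same_deg :: "pb list \<Rightarrow> pb list \<Rightarrow> bool" where
  "same_deg u v \<longleftrightarrow> length v = length u \<and> pb_ri (last v) = pb_ri (last u) \<and> x_count v = Suc (x_count u) \<and> xi_count v = Suc (xi_count u)"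

lemma dstep_same_deg: "dstep p u v \<Longrightarrow> same_deg u v"
proof (induction rule: dstep.induct)
  case (dstep_Cons w v \<alpha>)
  then have "w \<noteq> []" "v \<noteq> []" by (auto elim: dstep.cases)
  then show ?case using dstep_Cons by (auto simp: same_deg_def)
qed (auto simp: same_deg_def pb_ri_def)

lemma dstep_zigzag: "dstep p u v \<Longrightarrow> zigzag p l u \<Longrightarrow> zigzag p l v"
proof (induction arbitrary: l rule: dstep.induct)
  case (dstep_Cons w v \<alpha>)
  then show ?case by (cases \<alpha>) auto
qed auto

text \<open>Ensures that the source matched to a word of given degree and end points is a valid path
  one degree below.\<close>

lemma dstep_zigzag_back: "dstep p u v \<Longrightarrow> zigzag p l v \<Longrightarrow> zigzag p l u"
proof (induction arbitrary: l rule: dstep.induct)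
  case (dstep_Cons w v \<alpha>)
  then show ?case by (cases \<alpha>) auto
qed auto

text \<open>A path without xi that starts at 1 and stops short of p is a source if the next letter
  has no xi. If the next letter has xi, the word is a target. So an unmatched path runs to p, after
  which sigma restarts it at 1.\<close>

lemma front_match_crit:
  assumes "zigzag p 1 ((r,a,0) # w)" "1 < p"
    and "\<nexists>v. front_match p ((r,a,0) # w) v" "\<nexists>u. front_match p u ((r,a,0) # w)"
  shows "(r,a,0) # w = replicate (length w) (p,p-1,0) @ [(pb_ri (last ((r,a,0) # w)), pb_ri (last ((r,a,0) # w)) - 1, 0)]"
  using assms
proof (induction w arbitrary: r a)
  case Nil
  then show ?case by (auto simp: pb_ri_def)
next
  case (Cons \<beta> w)
  obtain r1 a1 b1 where \<beta>: "\<beta> = (r1,a1,b1)" by (cases \<beta>)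
  have r: "r = Suc a" "r \<le> p" "r1 = p + 1 - r + a1 + b1" "r1 \<le> p" "b1 \<le> 1"
    using Cons.prems(1) by (auto simp: \<beta>)
  have b1: "b1 = 0"
  proof (rule ccontr)
    assume "b1 \<noteq> 0"
    with r have "b1 = 1" "r1 = p + 1 - r + a1 + 1" by auto
    \<comment> \<open>With a = 0 the path would stop at 1 and the next letter would start at p,
      leaving no room for its xi.\<close>
    then obtain a' where "a = Suc a'" using r by (cases a) auto
    then have "front_match p ((a,a',0) # (r1,a1,0) # w) ((r,a,0) # \<beta> # w)"
      using front_match_base[of a p a' 0 r1 a1 w] r \<open>b1 = 1\<close> by (simp add: \<beta>)
    then show False using Cons.prems(4) by blast
  qed
  have "r = p"
  proof (rule ccontr)
    assume "r \<noteq> p"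
    then have "r < p" using r by simp
    then show False using Cons.prems(3) front_match_base b1 \<beta> by blast
  qed
  have "(r1,a1,0) # w = replicate (length w) (p,p-1,0) @ [(pb_ri (last ((r1,a1,0) # w)), pb_ri (last ((r1,a1,0) # w)) - 1, 0)]"
  proof (rule Cons.IH)
    show "zigzag p 1 ((r1,a1,0) # w)" using Cons.prems(1) b1 \<open>r = p\<close> by (auto simp: \<beta>)
    show "\<nexists>v. front_match p ((r1,a1,0) # w) v"
      using Cons.prems(3) front_match_rec unfolding \<open>r = p\<close> \<beta> b1 by blast
    show "\<nexists>u. front_match p u ((r1,a1,0) # w)"
    proof safe
      fix u assume u: "front_match p u ((r1,a1,0) # w)"
      then obtain r2 a2 w2 where "u = (r2,a2,0) # w2" by (auto simp: front_match_target_iff)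
      then show False using Cons.prems(4) front_match_rec u unfolding \<open>r = p\<close> \<beta> b1 by blast
    qed
  qed fact
  moreover have "last ((r,a,0) # \<beta> # w) = last ((r1,a1,0) # w)" by (simp add: \<beta> b1)
  moreover have "a = p - 1" using r \<open>r = p\<close> by simp
  ultimately show ?case
    unfolding \<open>r = p\<close> \<beta> b1 length_Cons replicate_Suc append_Cons by (simp only:)
qed

text \<open>The first alternative is a run to p followed by a full zigzag; the second is the prefix
  xi (x) xi, where every other pair of exponents is excluded by one of the two basic kinds of
  match.\<close>

lemma cell_match_crit:
  assumes "zigzag p s ((r0,a0,b0) # (r1,a1,b1) # w)" "s < p"
    and no: "\<nexists>v. cell_match p ((r0,a0,b0) # (r1,a1,b1) # w) v" "\<nexists>u. cell_match p u ((r0,a0,b0) # (r1,a1,b1) # w)"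
  defines "t \<equiv> pb_ri (last ((r1,a1,b1) # w))"
  shows "b1 = 0 \<and> r0 = p \<and> (r1,a1,b1) # w = replicate (length w) (p,p-1,0) @ [(t,t-1,0)] \<or>
    b1 \<noteq> 0 \<and> b1 = 1 \<and> a0 = 0 \<and> b0 = 1 \<and> a1 = 0"
proof (cases "b1 = 0")
  case True
  have p: "r0 = p"
  proof (rule ccontr)
    assume "r0 \<noteq> p"
    then have "r0 < p" using assms(1) by simp
    then show False using no(1) cell_match_A front_match_base True by blast
  qed
  have "(r1,a1,0) # w = replicate (length w) (p,p-1,0) @ [(pb_ri (last ((r1,a1,0) # w)), pb_ri (last ((r1,a1,0) # w)) - 1, 0)]"
  proof (rule front_match_crit)
    show "zigzag p 1 ((r1,a1,0) # w)" using assms(1) True p by auto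
    show "1 < p" using assms(1,2) by simp
    show "\<nexists>v. front_match p ((r1,a1,0) # w) v"
      using no(1) front_match_rec cell_match_A p True by blast
    show "\<nexists>u. front_match p u ((r1,a1,0) # w)"
    proof safe
      fix u assume u: "front_match p u ((r1,a1,0) # w)"
      then obtain r2 a2 w2 where "u = (r2,a2,0) # w2" by (auto simp: front_match_target_iff)
      then show False using no(2) front_match_rec cell_match_A u p True by blast
    qed
  qed
  then show ?thesis using True p unfolding t_def by blast
next
  case False
  then have b1: "b1 = 1" using assms(1) by simp
  have a0: "a0 = 0"
  proof (rule ccontr)
    assume "a0 \<noteq> 0"
    then obtain a r where "a0 = Suc a" "r0 = Suc r" using assms(1) by (cases a0; cases r0) auto
    moreover have "r < p" using assms(1) calculation by simp
    ultimately show False using no(2) cell_match_A front_match_base b1 by blast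
  qed
  have b0: "b0 = 1"
  proof (rule ccontr)
    assume "b0 \<noteq> 1"
    \<comment> \<open>Here \<open>s < p\<close> leaves room to extend an idempotent as first letter,
      so the word would be a source of \<open>cell_match_U\<close>.\<close>
    then have "b0 = 0" "r0 < p" using assms(1,2) a0 by auto
    then show False using no(1) cell_match_U b1 a0 by blast
  qed
  have "a1 = 0"
  proof (rule ccontr)
    assume "a1 \<noteq> 0"
    then obtain a r where "a1 = Suc a" "r0 = Suc r" using assms(1) b0 by (cases a1; cases r0) auto
    moreover have "r < p" using assms(1) calculation by simp
    ultimately show False using no(2) cell_match_U b1 a0 b0 by blast
  qed
  then show ?thesis using a0 b0 b1 by simp
qed

text \<open>The number of xi tells the two critical shapes apart: at most one for the full zigzag,
  at least two for the prefix xi (x) xi. In the first shape length and end point give the tail, the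
  number of xi gives \<open>b0\<close>, and \<open>r0 = p\<close> gives \<open>a0\<close>.\<close>

lemma cell_match_crit_unique:
  assumes "zigzag p s w" "zigzag p s w'" "s < p" "length w = length w'"
    "pb_ri (last w) = pb_ri (last w')" "xi_count w = xi_count w'"
    "\<nexists>v. cell_match p w v" "\<nexists>u. cell_match p u w" "\<nexists>v. cell_match p w' v" "\<nexists>u. cell_match p u w'"
  shows "w = w'"
  using assms
proof (induction w arbitrary: w' rule: match_weight.induct)
  case (1 r0 a0 b0 r1 a1 b1 w)
  obtain r0' a0' b0' r1' a1' b1' v where w': "w' = (r0',a0',b0') # (r1',a1',b1') # v"
    using 1(5) by (cases w'; cases "tl w'") auto
  note 1 = 1[unfolded w']
  have sb0: "xi_count (replicate n (p,p-1,0) @ [(t,t-1,0)]) = 0" for n t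
    by (induction n) auto
  consider "b1 = 0" "b1' = 0" | "b1 \<noteq> 0" "b1' = 0" | "b1 = 0" "b1' \<noteq> 0" | "b1 \<noteq> 0" "b1' \<noteq> 0" by blast
  then show ?case
  proof cases
    case c: 1
    let ?t = "pb_ri (last ((r1,a1,b1) # w))"
    have t': "?t = pb_ri (last ((r1',a1',b1') # v))" using 1(6) by simp
    have lw: "length w = length v" using 1(5) by simp
    have a: "r0 = p" "(r1,a1,b1) # w = replicate (length w) (p,p-1,0) @ [(?t,?t-1,0)]"
      using cell_match_crit[OF 1(2,4,8,9)] c by blast+
    have b: "r0' = p" "(r1',a1',b1') # v = replicate (length v) (p,p-1,0) @ [(?t,?t-1,0)]"
      using cell_match_crit[OF 1(3,4,10,11)] c unfolding t' by blast+
    have "(r1,a1,b1) # w = (r1',a1',b1') # v"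
      by (rule trans[OF a(2)]) (use b(2)[symmetric] in \<open>simp only: lw\<close>)
    moreover have "b0 = b0'"
      using 1(7) calculation by simp
    moreover have "a0 = a0'" using 1(2,3) a(1) b(1) \<open>b0 = b0'\<close> by auto
    ultimately show ?thesis using a(1) b(1) w' by simp
  next
    case c: 2
    have "(r1',a1',b1') # v = replicate (length v) (p,p-1,0) @ [(pb_ri (last ((r1',a1',b1') # v)), pb_ri (last ((r1',a1',b1') # v)) - 1, 0)]"
      using cell_match_crit[OF 1(3,4,10,11)] c by blast+
    then have "xi_count ((r1',a1',b1') # v) = 0" using sb0 by metis
    then have "xi_count ((r0',a0',b0') # (r1',a1',b1') # v) = b0'" by simp
    moreover have "b0' \<le> 1" using 1(3) by simp
    moreover have "b1 = 1" "b0 = 1" using cell_match_crit[OF 1(2,4,8,9)] c by blast+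
    then have "2 \<le> xi_count ((r0,a0,b0) # (r1,a1,b1) # w)" by simp
    ultimately show ?thesis using 1(7) by linarith
  next
    case c: 3
    have "(r1,a1,b1) # w = replicate (length w) (p,p-1,0) @ [(pb_ri (last ((r1,a1,b1) # w)), pb_ri (last ((r1,a1,b1) # w)) - 1, 0)]"
      using cell_match_crit[OF 1(2,4,8,9)] c by blast+
    then have "xi_count ((r1,a1,b1) # w) = 0" using sb0 by metis
    then have "xi_count ((r0,a0,b0) # (r1,a1,b1) # w) = b0" by simp
    moreover have "b0 \<le> 1" using 1(2) by simp
    moreover have "b1' = 1" "b0' = 1" using cell_match_crit[OF 1(3,4,10,11)] c by blast+
    then have "2 \<le> xi_count ((r0',a0',b0') # (r1',a1',b1') # v)" by simp
    ultimately show ?thesis using 1(7) by linarith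
  next
    case c: 4
    have a: "b1 = 1" "a0 = 0" "b0 = 1" "a1 = 0" using cell_match_crit[OF 1(2,4,8,9)] c by blast+
    have b: "b1' = 1" "a0' = 0" "b0' = 1" "a1' = 0" using cell_match_crit[OF 1(3,4,10,11)] c by blast+
    \<comment> \<open>After these two letters the path starts again at p + 1 - Suc (p - s) = s, so
      the induction hypothesis applies with the same s.\<close>
    have r: "r0 = Suc s" "r1 = Suc (p - s)" "r0' = Suc s" "r1' = Suc (p - s)"
      using 1(2,3,4) a b by auto
    have "w = v"
    proof (rule 1(1))
      show "zigzag p s w" "zigzag p s v" using 1(2,3,4) r a b by auto
      show "pb_ri (last w) = pb_ri (last v)" using 1(5,6) by (cases w; cases v) auto
      show "xi_count w = xi_count v" "length w = length v" using 1(5,7) a b by auto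
      show "\<nexists>v. cell_match p w v" using 1(8) cell_match_rec[of p w] unfolding a by blast
      show "\<nexists>u. cell_match p u w" using 1(9) cell_match_rec[of p _ w] unfolding a by blast
      show "\<nexists>u. cell_match p v u" using 1(10) cell_match_rec[of p v] unfolding b by blast
      show "\<nexists>u. cell_match p u v" using 1(11) cell_match_rec[of p _ v] unfolding b by blast
    qed (use a c 1(4) in auto)
    then show ?thesis using a b r w' by simp
  qed
next
  case ("2_2" \<alpha>)
  obtain r a b where \<alpha>: "\<alpha> = (r,a,b)" by (cases \<alpha>)
  obtain r' a' b' where w': "w' = [(r',a',b')]"
    using "2_2"(4) by (cases w'; cases "hd w'") auto
  show ?case using "2_2"(1,2,5,6) by (auto simp: \<alpha> w' pb_ri_def)
qed auto

section \<open>Degree pieces of the reduced complex and dependence of their cycles\<close>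

definition cells :: "nat \<Rightarrow> nat \<Rightarrow> nat \<Rightarrow> nat \<Rightarrow> int \<Rightarrow> int \<Rightarrow> pb list set" where
  "cells p N s t k b = {w. length w = N \<and> zigzag p s w \<and> pb_ri (last w) = t \<and> int (x_count w) = k \<and> int (xi_count w) = b}"

lemma finite_PB: "finite (PB p)"
  by (rule finite_subset[of _ "{..p} \<times> {..p} \<times> {..1}"]) (auto simp: PB_def)

lemma zigzag_PB: "zigzag p l w \<Longrightarrow> set w \<subseteq> PB p"
  by (induction p l w rule: zigzag.induct) (auto simp: PB_def)

lemma finite_cells: "finite (cells p N s t k b)"
  by (rule finite_subset[OF _ finite_lists_length_eq[OF finite_PB[of p], of N]])
    (auto simp: cells_def dest: zigzag_PB)

lemma dstep_cells: "dstep p u v \<Longrightarrow> u \<in> cells p N s t (k - 1) (b - 1) \<Longrightarrow> v \<in> cells p N s t k b"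
  by (auto simp: cells_def same_deg_def dest: dstep_same_deg intro: dstep_zigzag)

lemma dstep_cells_back: "dstep p u v \<Longrightarrow> v \<in> cells p N s t k b \<Longrightarrow> u \<in> cells p N s t (k - 1) (b - 1)"
  by (auto simp: cells_def same_deg_def dest: dstep_same_deg intro: dstep_zigzag_back)

lemma cells_cycles_dependent:
  fixes z1 z2 :: "pb list \<Rightarrow> 'f::field"
  assumes p: "2 \<le> p" and s: "s \<le> p" and N: "2 \<le> N"
    and z1: "\<And>w. z1 w \<noteq> 0 \<Longrightarrow> w \<in> cells p N s t k b" "lin_ext (zigzag_d p) z1 = 0"
    and z2: "\<And>w. z2 w \<noteq> 0 \<Longrightarrow> w \<in> cells p N s t k b" "lin_ext (zigzag_d p) z2 = 0"
  obtains c1 c2 y where "c1 \<noteq> 0 \<or> c2 \<noteq> 0" "\<And>w. y w \<noteq> 0 \<Longrightarrow> w \<in> cells p N s t (k - 1) (b - 1)"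
    "fscale c1 z1 + fscale c2 z2 = lin_ext (zigzag_d p) y"
proof -
  let ?X = "cells p N s t k b" and ?Y = "cells p N s t (k - 1) (b - 1)"
  \<comment> \<open>Stated for an arbitrary matching and weight, to serve both
    \<open>cell_match\<close> and its shift by one letter in the case \<open>s = p\<close>.\<close>
  have ex: "\<exists>c1 c2 y. (c1 \<noteq> 0 \<or> c2 \<noteq> 0) \<and> (\<forall>x. c1 * z1 x + c2 * z2 x = (\<Sum>u\<in>?Y. y u * zigzag_d p u x))"
    if m: "\<And>u v. m u v \<Longrightarrow> zigzag_d p u v \<noteq> (0 :: 'f)" "\<And>u v v'. m u v \<Longrightarrow> m u v' \<Longrightarrow> v = v'"
      "\<And>u v u' v'. m u v \<Longrightarrow> m u' v' \<Longrightarrow> dstep p u v' \<Longrightarrow> u = u' \<or> f u' < f u"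
      "\<And>x x'. x \<in> ?X \<Longrightarrow> x' \<in> ?X \<Longrightarrow> \<nexists>v. m x v \<Longrightarrow> \<nexists>v. m x' v \<Longrightarrow> \<nexists>u. m u x \<Longrightarrow> \<nexists>u. m u x' \<Longrightarrow> x = x'"
    for m and f :: "pb list \<Rightarrow> nat list"
  proof (rule morse[where m = m and wt = f])
    show "finite ?X" "finite ?Y" by (rule finite_cells)+
    show sub: "y \<in> ?Y \<Longrightarrow> zigzag_d p y x \<noteq> (0 :: 'f) \<Longrightarrow> x \<in> ?X" for y x
      using zigzag_d_nz_dstep dstep_cells by blast
    have lin_ext: "(\<Sum>x\<in>?X. z x * zigzag_d p x c) = lin_ext (zigzag_d p) z c"
      if "\<And>w. z w \<noteq> 0 \<Longrightarrow> w \<in> ?X" for z :: "pb list \<Rightarrow> 'f" and c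
      by (subst lin_ext_superset[OF finite_cells]) (use that in auto)
    show "(\<Sum>x\<in>?X. zigzag_d p y x * zigzag_d p x c) = (0 :: 'f)" if "y \<in> ?Y" for y c
      by (subst lin_ext) (use sub that in \<open>auto simp: zigzag_d_zigzag_d\<close>)
    show "(\<Sum>x\<in>?X. z1 x * zigzag_d p x c) = 0" "(\<Sum>x\<in>?X. z2 x * zigzag_d p x c) = 0" for c
      using lin_ext[of z1] lin_ext[of z2] z1 z2 by auto
    show "u = u' \<or> f u' < f u" if "m u v" "m u' v'" "zigzag_d p u v' \<noteq> (0 :: 'f)" for u v u' v'
      using m(3) that zigzag_d_nz_dstep by blast
    show "x = x'" if "x \<in> ?X" "x' \<in> ?X" "\<nexists>v. m x v" "\<nexists>v. m x' v"
      "\<not> (\<exists>u\<in>?Y. m u x)" "\<not> (\<exists>u\<in>?Y. m u x')" for x x'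
    proof -
      \<comment> \<open>A source matched to x lies in ?Y, so having no source in ?Y means having
        none at all.\<close>
      have "\<nexists>u. m u x" "\<nexists>u. m u x'"
        using that m(1) zigzag_d_nz_dstep dstep_cells_back by blast+
      then show ?thesis using m(4) that by blast
    qed
  qed (use m z1 z2 in blast)+
  have "\<exists>c1 c2 y. (c1 \<noteq> 0 \<or> c2 \<noteq> 0) \<and> (\<forall>x. c1 * z1 x + c2 * z2 x = (\<Sum>u\<in>?Y. y u * zigzag_d p u x))"
  proof (cases "s < p")
    case True
    show ?thesis
    proof (rule ex[of "cell_match p" match_weight])
      show "x = x'" if "x \<in> ?X" "x' \<in> ?X" "\<nexists>v. cell_match p x v" "\<nexists>v. cell_match p x' v" "\<nexists>u. cell_match p u x" "\<nexists>u. cell_match p u x'" for x x'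
        by (rule cell_match_crit_unique[of p s]) (use that True in \<open>auto simp: cells_def\<close>)
    qed (use cell_match_nz cell_match_fun cell_match_tri in blast)+
  next
    case False
    then have sp: "s = p" using s by simp
    show ?thesis
    proof (rule ex[of "\<lambda>u v. \<exists>u' v'. u = (p,0,0) # u' \<and> v = (p,0,0) # v' \<and> cell_match p u' v'" "match_weight \<circ> tl"]; (elim exE conjE)?)
      show "zigzag_d p u v \<noteq> (0 :: 'f)" if "u = (p,0,0) # u'" "v = (p,0,0) # v'" "cell_match p u' v'" for u v u' v'
        using that cell_match_nz by (auto simp: fscale_def)
      show "v = v'" if "u = (p,0,0) # u1" "v = (p,0,0) # v1" "cell_match p u1 v1"
        "u = (p,0,0) # u2" "v' = (p,0,0) # v2" "cell_match p u2 v2" for u v v' u1 u2 v1 v2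
        using that cell_match_fun by auto
      show "u = u' \<or> (match_weight \<circ> tl) u' < (match_weight \<circ> tl) u"
        if "dstep p u v'" "u = (p,0,0) # u1" "v = (p,0,0) # v1" "cell_match p u1 v1"
        "u' = (p,0,0) # u2" "v' = (p,0,0) # v2" "cell_match p u2 v2" for u v u' v' u1 u2 v1 v2
      proof -
        have "dstep p u1 v2" using that(1) unfolding that(2,6) by cases auto
        then show ?thesis using cell_match_tri[OF that(4) _ that(7)] that by auto
      qed
      show "x = x'" if x: "x \<in> ?X" "x' \<in> ?X"
        and no: "\<nexists>v u' v'. x = (p,0,0) # u' \<and> v = (p,0,0) # v' \<and> cell_match p u' v'"
         "\<nexists>v u' v'. x' = (p,0,0) # u' \<and> v = (p,0,0) # v' \<and> cell_match p u' v'"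
         "\<nexists>u u' v'. u = (p,0,0) # u' \<and> x = (p,0,0) # v' \<and> cell_match p u' v'"
         "\<nexists>u u' v'. u = (p,0,0) # u' \<and> x' = (p,0,0) # v' \<and> cell_match p u' v'" for x x'
      proof -
        \<comment> \<open>Since \<open>N\<close> is at least 2 the tail is nonempty, and its last
          letter is that of the whole word.\<close>
        have hd: "\<exists>y'. y = (p,0,0) # y' \<and> y' \<noteq> [] \<and> zigzag p 1 y'" if "y \<in> ?X" for y
          using that sp N by (cases y; cases "hd y"; cases "tl y") (auto simp: cells_def)
        obtain y y' where y: "x = (p,0,0) # y" "x' = (p,0,0) # y'" "y \<noteq> []" "y' \<noteq> []" "zigzag p 1 y" "zigzag p 1 y'"
          using hd[OF x(1)] hd[OF x(2)] by blast
        have "y = y'"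
          by (rule cell_match_crit_unique[of p 1]) (use y x p no in \<open>auto simp: cells_def\<close>)
        then show ?thesis using y by simp
      qed
    qed
  qed
  then obtain c1 c2 y where c: "c1 \<noteq> 0 \<or> c2 \<noteq> 0"
    and y: "\<And>x. c1 * z1 x + c2 * z2 x = (\<Sum>u\<in>?Y. y u * zigzag_d p u x)" by blast
  \<comment> \<open>The coefficients given by \<open>morse\<close> are arbitrary outside ?Y; cutting
    them off gives a chain of the right degree and finite support.\<close>
  define y' where "y' = (\<lambda>w. if w \<in> ?Y then y w else 0)"
  have "fscale c1 z1 + fscale c2 z2 = lin_ext (zigzag_d p) y'"
  proof
    fix x
    have "lin_ext (zigzag_d p) y' x = (\<Sum>u\<in>?Y. y' u * zigzag_d p u x)"
      by (rule lin_ext_superset[OF finite_cells]) (auto simp: y'_def)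
    then show "(fscale c1 z1 + fscale c2 z2) x = lin_ext (zigzag_d p) y' x"
      using y[of x] by (simp add: fscale_def y'_def)
  qed
  moreover have "w \<in> ?Y" if "y' w \<noteq> 0" for w
    using that by (auto simp: y'_def split: if_splits)
  ultimately show ?thesis using that c by blast
qed

section \<open>Homology of the quotient by the tensor relations\<close>

interpretation fvs: vector_space "fscale :: 'f::field \<Rightarrow> ('x \<Rightarrow> 'f) \<Rightarrow> 'x \<Rightarrow> 'f"
  by unfold_locales (auto simp: fscale_def algebra_simps)

text \<open>Either Z lies in B, or some z0 in Z outside B spans Z together with a basis of B. The
  finite set F makes that basis finite, so that cardinalities measure dimension.\<close>

lemma dim_diff_le_1:
  fixes B Z :: "('x \<Rightarrow> 'f::field) set"
  assumes "B \<subseteq> fspan F" "finite F" "fvs.subspace B"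
    and dep: "\<And>z1 z2. z1 \<in> Z \<Longrightarrow> z2 \<in> Z \<Longrightarrow> \<exists>c1 c2. (c1 \<noteq> 0 \<or> c2 \<noteq> 0) \<and> fscale c1 z1 + fscale c2 z2 \<in> B"
  shows "fdim Z - fdim B \<le> 1"
proof -
  obtain b where b: "b \<subseteq> B" "fvs.independent b" "B \<subseteq> fspan b" "card b = fdim B"
    using fvs.basis_exists[of B] by blast
  have fb: "finite b"
    using fvs.independent_span_bound[OF assms(2) b(2)] b(1) assms(1) by blast
  obtain z0 where z0: "Z \<subseteq> fspan (insert z0 b)"
  proof (cases "Z \<subseteq> B")
    case True
    then show ?thesis using b(3) fvs.span_mono[of b "insert 0 b"] by (intro that[of 0]) blast
  next
    case False
    then obtain z0 where z0: "z0 \<in> Z" "z0 \<notin> B" by blast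
    have "z \<in> fspan (insert z0 b)" if z: "z \<in> Z" for z
    proof -
      obtain c1 c2 where c: "c1 \<noteq> 0 \<or> c2 \<noteq> 0" "fscale c1 z0 + fscale c2 z \<in> B"
        using dep[OF z0(1) z] by blast
      \<comment> \<open>Otherwise a nonzero multiple of z0 would lie in B.\<close>
      have "c2 \<noteq> 0"
      proof
        assume "c2 = 0"
        then have "fscale (inverse c1) (fscale c1 z0) \<in> B"
          using c assms(3) fvs.subspace_scale by fastforce
        then show False using z0(2) c \<open>c2 = 0\<close> by simp
      qed
      have "fscale (inverse c2) ((fscale c1 z0 + fscale c2 z) - fscale c1 z0) \<in> fspan (insert z0 b)"
        by (intro fvs.span_scale fvs.span_diff)
          (use c(2) b(3) fvs.span_mono[of b "insert z0 b"] in \<open>auto intro: fvs.span_base\<close>)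
      then show ?thesis using \<open>c2 \<noteq> 0\<close> by simp
    qed
    then show ?thesis by (intro that[of z0]) blast
  qed
  have "fdim Z \<le> card (insert z0 b)"
    by (rule fvs.dim_le_card[OF z0]) (use fb in simp)
  also have "\<dots> \<le> Suc (card b)" by (simp add: card_insert_le_m1 fb card_insert_if)
  finally show ?thesis using b(4) by simp
qed

lemma subspace_Vsp: "fvs.subspace (Vsp M n)"
  unfolding fvs.subspace_def Vsp_def by (auto simp: fscale_def) (metis add_0)

lemma lin_ext_sum: "lin_ext f v = (\<Sum>x | v x \<noteq> 0. fscale (v x) (f x))"
  by (auto simp: lin_ext_def fscale_def sum_fun_app)

lemma lin_ext_in_span:
  assumes "\<And>x. v x \<noteq> 0 \<Longrightarrow> f x \<in> fspan S"
  shows "lin_ext f v \<in> fspan S"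
  unfolding lin_ext_sum by (intro fvs.span_sum fvs.span_scale assms) auto

lemma finite_words: "finite (bas M) \<Longrightarrow> finite (words M n)"
  using finite_lists_length_eq[of "bas M" n] by (simp add: words_def conj_commute)

lemma fin_supp_Vsp: "finite (bas M) \<Longrightarrow> v \<in> Vsp M n \<Longrightarrow> fin_supp v"
  unfolding fin_supp_def by (rule finite_subset[OF _ finite_words[of M n]]) (auto simp: Vsp_def)

lemma Vsp_span:
  assumes "finite (bas M)"
  shows "Vsp M n \<subseteq> fspan (ind ` words M n)"
proof
  fix v assume v: "v \<in> Vsp M n"
  have "lin_ext ind v \<in> fspan (ind ` words M n)"
    by (rule lin_ext_in_span, rule fvs.span_base) (use v in \<open>auto simp: Vsp_def\<close>)
  then show "v \<in> fspan (ind ` words M n)" using fin_supp_Vsp[OF assms v] by (simp add: lin_ext_ind_id)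
qed

lemma dlin_lin_ext: "finite (bas M) \<Longrightarrow> v \<in> Vsp M n \<Longrightarrow> dlin M n v = lin_ext (dword M) v"
  by (rule ext, subst lin_ext_superset[OF finite_words[of M n]])
    (auto simp: dlin_def Vsp_def sum_fun_app fscale_def)

text \<open>Combinations of elements of Qd stay in Qd, so dependence modulo dV + R suffices; the
  inclusions into \<open>Vsp\<close> bound everything by a finite-dimensional space.\<close>

lemma hdim_le_1:
  fixes M :: "('b, 'f::field) bimod" and p n s t :: nat and j k :: int
  defines "R \<equiv> fspan (rels p M n)"
  defines "Vd \<equiv> {v \<in> Vsp M n. \<forall>w. v w \<noteq> 0 \<longrightarrow> w \<in> words_deg M n s t j k}"
  assumes fin: "finite (bas M)" and R: "rels p M n \<subseteq> Vsp M n" and dV: "dlin M n ` Vsp M n \<subseteq> Vsp M n"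
    and dep: "\<And>z1 z2. z1 \<in> fspan (Vd \<union> R) \<Longrightarrow> z2 \<in> fspan (Vd \<union> R) \<Longrightarrow>
      dlin M n z1 \<in> R \<Longrightarrow> dlin M n z2 \<in> R \<Longrightarrow>
      \<exists>c1 c2. (c1 \<noteq> 0 \<or> c2 \<noteq> 0) \<and> fscale c1 z1 + fscale c2 z2 \<in> fspan (dlin M n ` Vsp M n \<union> R)"
  shows "hdim p M n s t j k \<le> 1"
  unfolding hdim_def Let_def R_def[symmetric] Vd_def[symmetric]
proof (rule dim_diff_le_1)
  have "R \<subseteq> Vsp M n" unfolding R_def by (rule fvs.span_minimal[OF R subspace_Vsp])
  then have "fspan (dlin M n ` Vsp M n \<union> R) \<subseteq> Vsp M n"
    by (intro fvs.span_minimal subspace_Vsp) (use dV in blast)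
  then show "fspan (dlin M n ` Vsp M n \<union> R) \<inter> fspan (Vd \<union> R) \<subseteq> fspan (ind ` words M n)"
    using Vsp_span[OF fin] by blast
  show "finite (ind ` words M n)" by (simp add: finite_words fin)
  show "fvs.subspace (fspan (dlin M n ` Vsp M n \<union> R) \<inter> fspan (Vd \<union> R))"
    by (intro fvs.subspace_inter fvs.subspace_span)
  show "\<exists>c1 c2. (c1 \<noteq> 0 \<or> c2 \<noteq> 0) \<and>
      fscale c1 z1 + fscale c2 z2 \<in> fspan (dlin M n ` Vsp M n \<union> R) \<inter> fspan (Vd \<union> R)"
    if "z1 \<in> {v \<in> fspan (Vd \<union> R). dlin M n v \<in> R}" "z2 \<in> {v \<in> fspan (Vd \<union> R). dlin M n v \<in> R}" for z1 z2
  proof -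
    have "\<exists>c1 c2. (c1 \<noteq> 0 \<or> c2 \<noteq> 0) \<and> fscale c1 z1 + fscale c2 z2 \<in> fspan (dlin M n ` Vsp M n \<union> R)"
      by (rule dep) (use that in simp_all)
    moreover have "fscale c1 z1 + fscale c2 z2 \<in> fspan (Vd \<union> R)" for c1 c2
      using that by (intro fvs.span_add fvs.span_scale) auto
    ultimately show ?thesis by blast
  qed
qed

section \<open>Tensor powers of the inverse bimodule\<close>

text \<open>The last right factor meets no further left factor and stays as a letter of its own,
  whence the value on the empty word: n pairs become n + 1 letters.\<close>

fun left_mono :: "pb \<Rightarrow> pb list \<Rightarrow> pb list \<Rightarrow> 'f::field" where
  "left_mono \<beta> [] = ind [\<beta>]"
| "left_mono \<beta> (\<gamma> # v) = (case pb_mult \<beta> \<gamma> of None \<Rightarrow> 0 | Some \<delta> \<Rightarrow> ind (\<delta> # v))"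

text \<open>Moving all right factors across the tensor signs sends
  (alpha_1,beta_1) ... (alpha_n,beta_n) to alpha_1, beta_1 alpha_2, ..., beta_(n-1) alpha_n, beta_n.\<close>

fun contract :: "(pb \<times> pb) list \<Rightarrow> pb list \<Rightarrow> 'f::field" where
  "contract [] = ind []"
| "contract ((\<alpha>,\<beta>) # w) = cons_lin \<alpha> (lin_ext (left_mono \<beta>) (contract w))"

lemma fin_supp_left_mono [simp]: "fin_supp (left_mono \<beta> v)"
  by (cases v) (auto split: option.splits)

lemma fin_supp_contract [simp]: "fin_supp (contract w :: pb list \<Rightarrow> 'f::field)"
proof (induction w)
  case Nil
  show "fin_supp (contract [] :: pb list \<Rightarrow> 'f)" by simp
next
  case (Cons m w)
  have "fin_supp (contract w :: pb list \<Rightarrow> 'f)" by (rule Cons)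
  then show "fin_supp (contract (m # w) :: pb list \<Rightarrow> 'f)" by (cases m) simp
qed

lemma lin_ext_left_mono_cons_lin:
  assumes "fin_supp v"
  shows "lin_ext (left_mono \<beta>) (cons_lin \<gamma> v) = (case pb_mult \<beta> \<gamma> of None \<Rightarrow> 0 | Some \<delta> \<Rightarrow> cons_lin \<delta> v)"
  by (auto simp: lin_ext_cons_lin lin_ext_ind_Cons[OF assms] split: option.split)

lemma pb_mult_Some: "pb_mult (r1,a1,b1) (r2,a2,b2) = Some \<delta> \<longleftrightarrow>
    r1 = r2 - a2 - b2 \<and> b1 + b2 \<le> 1 \<and> \<delta> = (r2,a1+a2,b1+b2)"
  by (auto simp: pb_mult_def)

lemma pb_mult_assoc:
  "(case pb_mult \<alpha> \<beta> of None \<Rightarrow> None | Some \<delta> \<Rightarrow> pb_mult \<delta> \<gamma>)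
   = (case pb_mult \<beta> \<gamma> of None \<Rightarrow> None | Some \<delta> \<Rightarrow> pb_mult \<alpha> \<delta>)"
proof -
  obtain r1 a1 b1 r2 a2 b2 r3 a3 b3 where *: "\<alpha> = (r1,a1,b1)" "\<beta> = (r2,a2,b2)" "\<gamma> = (r3,a3,b3)"
    by (cases \<alpha>, cases \<beta>, cases \<gamma>)
  have r: "r3 - (a2 + a3) - (b2 + b3) = r3 - a3 - b3 - a2 - b2" by simp
  show ?thesis
  proof (cases "r2 = r3 - a3 - b3")
    case True
    show ?thesis unfolding * pb_mult_def prod.case True r[symmetric]
      by (cases "r1 = r3 - (a2 + a3) - (b2 + b3)"; cases "b1 + b2 + b3 \<le> 1")
        (simp_all add: r True add.assoc)
  qed (simp add: * pb_mult_def)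
qed

text \<open>At the first junction d multiplies the first letter on its right, so left multiplication
  by a monomial commutes with d up to the Koszul sign of its k-degree.\<close>

lemma zigzag_d_left_mono: "lin_ext (zigzag_d p) (left_mono (r,a,b) v) = fscale (ksign (int a)) (lin_ext (left_mono (r,a,b)) (zigzag_d p v))"
proof (cases v)
  case (Cons \<gamma> w)
  obtain r1 a1 b1 where \<gamma>: "\<gamma> = (r1,a1,b1)" by (cases \<gamma>)
  show ?thesis
    by (cases "r = r1 - a1 - b1"; cases "b + b1 \<le> 1"; cases "b1 = 0"; cases "b = 0"; cases "r1 < p")
      (auto simp: Cons \<gamma> pb_mult_def lin_ext_fscale lin_ext_add lin_ext_left_mono_cons_lin ksign_add algebra_simps)
qed simp

text \<open>These pull an x or xi standing in front of a right factor out of the product, turning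
  the differential of a pair into that of a junction of the reduced word.\<close>

lemma left_xi_left_mono: "left_mono (r,a,1) v = lin_ext left_xi (left_mono (r,a,0) v)"
  and left_xi_left_mono_0: "b \<noteq> 0 \<Longrightarrow> lin_ext left_xi (left_mono (r,a,b) v) = 0"
  and left_x_left_mono: "left_mono (r,Suc a,b) v = lin_ext left_x (left_mono (r,a,b) v)"
  by (cases v; cases "hd v"; auto simp: pb_mult_def)+

lemma subst_at_0:
  assumes "fin_supp c"
  shows "subst_at (m # w) 0 c = lin_ext (\<lambda>m'. ind (m' # w)) c"
proof
  fix w'
  show "subst_at (m # w) 0 c w' = lin_ext (\<lambda>m'. ind (m' # w)) c w'"
  proof (cases w')
    case Nil
    then show ?thesis by (simp add: subst_at_def lin_ext_def ind_def)
  next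
    case (Cons m' u)
    have "lin_ext (\<lambda>m'. ind (m' # w)) c w' = (\<Sum>x\<in>insert m' {x. c x \<noteq> 0}. c x * ind (x # w) w')"
      by (rule lin_ext_superset) (use assms in \<open>auto simp: fin_supp_def\<close>)
    also have "\<dots> = (\<Sum>x\<in>{m'}. c x * ind (x # w) w')"
      by (rule sum.mono_neutral_right) (use assms in \<open>auto simp: fin_supp_def ind_def Cons\<close>)
    also have "\<dots> = (if u = w then c m' else 0)" by (simp add: ind_def Cons)
    also have "\<dots> = subst_at (m # w) 0 c w'"
    proof -
      have "(length u = length w \<and> (\<forall>j<Suc (length w). j \<noteq> 0 \<longrightarrow> (m' # u) ! j = (m # w) ! j)) \<longleftrightarrow> u = w"
        unfolding All_less_Suc2 by (auto intro: nth_equalityI)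
      then show ?thesis by (auto simp: subst_at_def Cons)
    qed
    finally show ?thesis by simp
  qed
qed

lemma subst_at_Suc: "subst_at (m # w) (Suc i) c = cons_lin m (subst_at w i c)"
proof
  fix w'
  show "subst_at (m # w) (Suc i) c w' = cons_lin m (subst_at w i c) w'"
    by (cases w') (auto simp: subst_at_def cons_lin_def All_less_Suc2)
qed

lemma cons_lin_sum: "cons_lin a (\<Sum>i\<in>A. f i) = (\<Sum>i\<in>A. cons_lin a (f i))"
  by (rule ext) (auto simp: cons_lin_def sum_fun_app split: list.split)

lemma fscale_sum: "fscale c (\<Sum>i\<in>A. f i) = (\<Sum>i\<in>A. fscale c (f i))"
  by (rule ext) (auto simp: fscale_def sum_fun_app sum_distrib_left)

lemma dword_Cons:
  assumes "fin_supp (dg M m)"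
  shows "dword M (m # w) = lin_ext (\<lambda>m'. ind (m' # w)) (dg M m) + fscale (ksign (kd M m)) (cons_lin m (dword M w))"
  unfolding dword_def length_Cons sum.lessThan_Suc_shift
  by (simp add: subst_at_0[OF assms] subst_at_Suc cons_lin_sum fscale_sum cons_lin_fscale ksign_add)
    (simp add: ksign_def)

lemma dword_Nil [simp]: "dword M [] = 0"
  by (simp add: dword_def)

section \<open>Structure maps of the inverse bimodule on basis elements\<close>

abbreviation MI :: "nat \<Rightarrow> (pb \<times> pb, 'f::field) bimod" where "MI \<equiv> maltinvM"

lemma lmul_ind:
  assumes "\<psi> \<in> PB p"
  shows "lmul p (ind \<psi>) \<alpha> = (case pb_mult \<psi> \<alpha> of None \<Rightarrow> 0 | Some \<gamma> \<Rightarrow> ind \<gamma>)"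
proof
  fix \<gamma>
  have "lmul p (ind \<psi>) \<alpha> \<gamma> = (\<Sum>\<psi>'\<in>{\<psi>}. ind \<psi> \<psi>' * (if pb_mult \<psi>' \<alpha> = Some \<gamma> then 1 else 0))"
    unfolding lmul_def by (rule sum.mono_neutral_right) (use assms finite_PB in \<open>auto simp: ind_def\<close>)
  then show "lmul p (ind \<psi>) \<alpha> \<gamma> = (case pb_mult \<psi> \<alpha> of None \<Rightarrow> 0 | Some \<gamma> \<Rightarrow> ind \<gamma>) \<gamma>"
    by (auto simp: ind_def split: option.splits)
qed

lemma rmul_ind:
  assumes "\<psi> \<in> PB p"
  shows "rmul p \<alpha> (ind \<psi>) = (case pb_mult \<alpha> \<psi> of None \<Rightarrow> 0 | Some \<gamma> \<Rightarrow> ind \<gamma>)"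
proof
  fix \<gamma>
  have "rmul p \<alpha> (ind \<psi>) \<gamma> = (\<Sum>\<psi>'\<in>{\<psi>}. ind \<psi> \<psi>' * (if pb_mult \<alpha> \<psi>' = Some \<gamma> then 1 else 0))"
    unfolding rmul_def by (rule sum.mono_neutral_right) (use assms finite_PB in \<open>auto simp: ind_def\<close>)
  then show "rmul p \<alpha> (ind \<psi>) \<gamma> = (case pb_mult \<alpha> \<psi> of None \<Rightarrow> 0 | Some \<gamma> \<Rightarrow> ind \<gamma>) \<gamma>"
    by (auto simp: ind_def split: option.splits)
qed

lemma sum_one:
  fixes f :: "'x \<Rightarrow> 'f::field"
  assumes "finite A" "\<And>x. x \<in> A \<Longrightarrow> f x \<noteq> 0 \<Longrightarrow> x = c"
  shows "sum f A = (if c \<in> A then f c else 0)"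
proof -
  have "sum f A = sum f (A \<inter> {c})"
    by (rule sum.mono_neutral_right) (use assms in auto)
  then show ?thesis by auto
qed

text \<open>Of the sum x, only the summand from r to r + 1 composes with a monomial ending at r, and
  for r = p there is none. The next three lemmas follow the same pattern.\<close>

lemma rmul_x:
  assumes "(r,a,b) \<in> PB p"
  shows "rmul p (r,a,b) (x_el p) = (if r < p then ind (Suc r,Suc a,b) else 0)"
proof
  fix \<gamma>
  have "rmul p (r,a,b) (x_el p) \<gamma> = (if (Suc r,1,0) \<in> PB p then
     x_el p (Suc r,1,0) * (if pb_mult (r,a,b) (Suc r,1,0) = Some \<gamma> then 1 else 0) else 0)"
    unfolding rmul_def
    by (rule sum_one[OF finite_PB]) (auto simp: x_el_def pb_mult_def split: if_splits)
  also have "\<dots> = (if r < p then ind (Suc r,Suc a,b) else 0) \<gamma>"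
    using assms by (auto simp: PB_def x_el_def pb_mult_def ind_def)
  finally show "rmul p (r,a,b) (x_el p) \<gamma> = (if r < p then ind (Suc r,Suc a,b) else 0) \<gamma>" .
qed

lemma rmul_xi:
  assumes "(r,a,b) \<in> PB p"
  shows "rmul p (r,a,b) (xi_el p) = (if r < p \<and> b = 0 then ind (Suc r,a,1) else 0)"
proof
  fix \<gamma>
  have "rmul p (r,a,b) (xi_el p) \<gamma> = (if (Suc r,0,1) \<in> PB p then
     xi_el p (Suc r,0,1) * (if pb_mult (r,a,b) (Suc r,0,1) = Some \<gamma> then 1 else 0) else 0)"
    unfolding rmul_def
    by (rule sum_one[OF finite_PB]) (auto simp: xi_el_def pb_mult_def split: if_splits)
  also have "\<dots> = (if r < p \<and> b = 0 then ind (Suc r,a,1) else 0) \<gamma>"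
    using assms by (auto simp: PB_def xi_el_def pb_mult_def ind_def)
  finally show "rmul p (r,a,b) (xi_el p) \<gamma> = (if r < p \<and> b = 0 then ind (Suc r,a,1) else 0) \<gamma>" .
qed

lemma lmul_x:
  assumes "(r,a,b) \<in> PB p"
  shows "lmul p (x_el p) (r,a,b) = (if a + b + 2 \<le> r then ind (r,Suc a,b) else 0)"
proof
  fix \<gamma>
  have "lmul p (x_el p) (r,a,b) \<gamma> = (if (r-a-b,1,0) \<in> PB p then
     x_el p (r-a-b,1,0) * (if pb_mult (r-a-b,1,0) (r,a,b) = Some \<gamma> then 1 else 0) else 0)"
    unfolding lmul_def
    by (rule sum_one[OF finite_PB]) (auto simp: x_el_def pb_mult_def split: if_splits)
  also have "\<dots> = (if a + b + 2 \<le> r then ind (r,Suc a,b) else 0) \<gamma>"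
    using assms by (auto simp: PB_def x_el_def pb_mult_def ind_def)
  finally show "lmul p (x_el p) (r,a,b) \<gamma> = (if a + b + 2 \<le> r then ind (r,Suc a,b) else 0) \<gamma>" .
qed

lemma lmul_xi:
  assumes "(r,a,b) \<in> PB p"
  shows "lmul p (xi_el p) (r,a,b) = (if a + b + 2 \<le> r \<and> b = 0 then ind (r,a,1) else 0)"
proof
  fix \<gamma>
  have "lmul p (xi_el p) (r,a,b) \<gamma> = (if (r-a-b,0,1) \<in> PB p then
     xi_el p (r-a-b,0,1) * (if pb_mult (r-a-b,0,1) (r,a,b) = Some \<gamma> then 1 else 0) else 0)"
    unfolding lmul_def
    by (rule sum_one[OF finite_PB]) (auto simp: xi_el_def pb_mult_def split: if_splits)
  also have "\<dots> = (if a + b + 2 \<le> r \<and> b = 0 then ind (r,a,1) else 0) \<gamma>"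
    using assms by (auto simp: PB_def xi_el_def pb_mult_def ind_def)
  finally show "lmul p (xi_el p) (r,a,b) \<gamma> = (if a + b + 2 \<le> r \<and> b = 0 then ind (r,a,1) else 0) \<gamma>" .
qed

lemma MI_bas: "((r,a,b),(r',a',b')) \<in> bas (MI p) \<longleftrightarrow>
    (r,a,b) \<in> PB p \<and> (r',a',b') \<in> PB p \<and> r + (r' - a' - b') = p + 1"
  by (auto simp: maltinvM_def pb_ri_def pb_li_def)

lemma MI_bas_iff: "(\<alpha>,\<beta>) \<in> bas (MI p) \<longleftrightarrow> \<alpha> \<in> PB p \<and> \<beta> \<in> PB p \<and> pb_ri \<alpha> + pb_li \<beta> = p + 1"
  by (auto simp: maltinvM_def)

lemma finite_MI: "finite (bas (MI p))"
  by (rule finite_subset[of _ "PB p \<times> PB p"]) (auto simp: maltinvM_def finite_PB)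

lemma ind_Pair: "ind (a,b) (c,d) = ind a c * ind b d"
  by (simp add: ind_def)

lemma MI_dg:
  assumes "((r,a,b),(r',a',b')) \<in> bas (MI p :: (pb \<times> pb,'f::field) bimod)"
  shows "dg (MI p :: (pb \<times> pb,'f::field) bimod) ((r,a,b),(r',a',b')) = fscale (ksign (int a)) (if r < p then
      (if b' = 0 then ind ((Suc r,Suc a,b),(r',a',1)) else 0)
      + (if b = 0 then ind ((Suc r,a,1),(r',Suc a',b')) else 0) else 0)"
proof
  fix x :: "pb \<times> pb"
  obtain \<gamma> \<delta> where x: "x = (\<gamma>,\<delta>)" by (cases x)
  let ?rhs = "fscale (ksign (int a)) (if r < p then
      (if b' = 0 then ind ((Suc r,Suc a,b),(r',a',1)) else 0)
      + (if b = 0 then ind ((Suc r,a,1),(r',Suc a',b')) else 0) else 0) (\<gamma>,\<delta>) :: 'f"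
  have PB: "(r,a,b) \<in> PB p" "(r',a',b') \<in> PB p" and r: "r + (r' - a' - b') = p + 1"
    using assms by (auto simp: MI_bas)
  \<comment> \<open>The left idempotent of the right factor is p + 1 - r, so it has room for one
    more letter on the left exactly when r < p.\<close>
  have iff: "a' + b' + 2 \<le> r' \<longleftrightarrow> r < p"
    using PB r by (auto simp: PB_def)
  have core: "ksign (int a) * (rmul p (r,a,b) (x_el p) \<gamma> * lmul p (xi_el p) (r',a',b') \<delta>
      + rmul p (r,a,b) (xi_el p) \<gamma> * lmul p (x_el p) (r',a',b') \<delta>) = ?rhs"
    unfolding rmul_x[OF PB(1)] rmul_xi[OF PB(1)] lmul_x[OF PB(2)] lmul_xi[OF PB(2)] iff
    by (simp add: fscale_def ind_Pair)
  \<comment> \<open>A step raises the right index of the first factor and lowers the left index of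
    the second by one, so the guard p + 1 in the definition is preserved.\<close>
  have grd: "pb_ri \<gamma> + pb_li \<delta> = p + 1" if nz: "?rhs \<noteq> 0"
  proof -
    have "r < p" using nz by (auto simp: fscale_def split: if_splits)
    have "Suc r + (r' - Suc a' - b') = p + 1" "b' = 0 \<Longrightarrow> Suc r + (r' - a' - 1) = p + 1"
      using r iff \<open>r < p\<close> by simp_all
    then have g: "pb_ri (Suc r,a,1) + pb_li (r',Suc a',b') = p + 1"
      "b' = 0 \<Longrightarrow> pb_ri (Suc r,Suc a,b) + pb_li (r',a',1) = p + 1"
      by (simp_all only: pb_ri_def pb_li_def prod.case)
    consider "b' = 0" "\<gamma> = (Suc r,Suc a,b)" "\<delta> = (r',a',1)"
      | "\<gamma> = (Suc r,a,1)" "\<delta> = (r',Suc a',b')"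
      using nz by (auto simp: fscale_def ind_Pair ind_def split: if_splits)
    then show ?thesis by cases (use g in simp_all)
  qed
  have val: "dg (MI p) ((r,a,b),(r',a',b')) x = (if pb_ri \<gamma> + pb_li \<delta> = p + 1 then
      ksign (int a) * (rmul p (r,a,b) (x_el p) \<gamma> * lmul p (xi_el p) (r',a',b') \<delta>
      + rmul p (r,a,b) (xi_el p) \<gamma> * lmul p (x_el p) (r',a',b') \<delta>) else 0 :: 'f)"
    by (simp add: x maltinvM_def pb_k_def)
  show "dg (MI p :: (pb \<times> pb,'f) bimod) ((r,a,b),(r',a',b')) x = fscale (ksign (int a)) (if r < p then
      (if b' = 0 then ind ((Suc r,Suc a,b),(r',a',1)) else 0)
      + (if b = 0 then ind ((Suc r,a,1),(r',Suc a',b')) else 0) else 0) x"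
  proof (cases "pb_ri \<gamma> + pb_li \<delta> = p + 1")
    case True
    show ?thesis unfolding val using core True by (simp only: if_True x simp_thms)
  next
    case False
    then have "?rhs = 0" using grd by blast
    then show ?thesis unfolding val using False by (simp only: if_False x)
  qed
qed

lemma fin_supp_MI_dg: "m \<in> bas (MI p :: (pb \<times> pb,'f::field) bimod) \<Longrightarrow> fin_supp (dg (MI p :: (pb \<times> pb,'f::field) bimod) m)"
  by (cases m; cases "fst m"; cases "snd m") (auto simp: MI_dg)

lemma pb_mult_li: "pb_mult \<alpha> \<beta> = Some \<gamma> \<Longrightarrow> pb_li \<gamma> = pb_li \<alpha>"
  and pb_mult_ri: "pb_mult \<alpha> \<beta> = Some \<gamma> \<Longrightarrow> pb_ri \<gamma> = pb_ri \<beta>"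
  by (cases \<alpha>; cases \<beta>; simp add: pb_mult_Some pb_li_def pb_ri_def)+

lemma ind_eq_0: "ind y z = (0 :: 'f::field) \<longleftrightarrow> z \<noteq> y"
  by (simp add: ind_def)

lemma MI_lact:
  assumes "(\<alpha>,\<beta>) \<in> bas (MI p :: (pb \<times> pb,'f::field) bimod)" "\<psi> \<in> PB p"
  shows "lact (MI p :: (pb \<times> pb,'f::field) bimod) \<psi> (\<alpha>,\<beta>) = (case pb_mult \<psi> \<alpha> of None \<Rightarrow> 0 | Some \<gamma> \<Rightarrow> ind (\<gamma>,\<beta>))"
proof
  fix x :: "pb \<times> pb"
  obtain \<gamma> \<delta> where x: "x = (\<gamma>,\<delta>)" by (cases x)
  have "pb_ri \<alpha> + pb_li \<beta> = p + 1" using assms by (simp add: MI_bas_iff)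
  then show "lact (MI p :: (pb \<times> pb,'f) bimod) \<psi> (\<alpha>,\<beta>) x = (case pb_mult \<psi> \<alpha> of None \<Rightarrow> 0 | Some \<gamma> \<Rightarrow> ind (\<gamma>,\<beta>)) x"
    by (cases "pb_mult \<psi> \<alpha>") (auto simp: x maltinvM_def lmul_ind[OF assms(2)] ind_Pair ind_eq_0 pb_mult_ri)
qed

lemma MI_ract:
  assumes "(\<alpha>,\<beta>) \<in> bas (MI p :: (pb \<times> pb,'f::field) bimod)" "\<psi> \<in> PB p"
  shows "ract (MI p :: (pb \<times> pb,'f::field) bimod) (\<alpha>,\<beta>) \<psi> = (case pb_mult \<beta> \<psi> of None \<Rightarrow> 0 | Some \<delta> \<Rightarrow> ind (\<alpha>,\<delta>))"
proof
  fix x :: "pb \<times> pb"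
  obtain \<gamma> \<delta> where x: "x = (\<gamma>,\<delta>)" by (cases x)
  have "pb_ri \<alpha> + pb_li \<beta> = p + 1" using assms by (simp add: MI_bas_iff)
  then show "ract (MI p :: (pb \<times> pb,'f) bimod) (\<alpha>,\<beta>) \<psi> x = (case pb_mult \<beta> \<psi> of None \<Rightarrow> 0 | Some \<delta> \<Rightarrow> ind (\<alpha>,\<delta>)) x"
    by (cases "pb_mult \<beta> \<psi>") (auto simp: x maltinvM_def rmul_ind[OF assms(2)] ind_Pair ind_eq_0 pb_mult_li)
qed

section \<open>Contraction is a chain map and kills the tensor relations\<close>

lemma words_Cons: "m # w \<in> words M (Suc n) \<longleftrightarrow> m \<in> bas M \<and> w \<in> words M n"
  by (auto simp: words_def)

lemma lin_ext_contract_cons_lin: "fin_supp v \<Longrightarrow> lin_ext contract (cons_lin (\<alpha>,\<beta>) v) = cons_lin \<alpha> (lin_ext (left_mono \<beta>) (lin_ext contract v))"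
  by (simp add: lin_ext_cons_lin lin_ext_comp cons_lin_lin_ext)

lemma fin_supp_dword:
  assumes "w \<in> words (MI p :: (pb \<times> pb,'f::field) bimod) n"
  shows "fin_supp (dword (MI p) w :: _ \<Rightarrow> 'f::field)"
  using assms
proof (induction w arbitrary: n)
  case Nil
  show "fin_supp (dword (MI p) [] :: _ \<Rightarrow> 'f)" by simp
next
  case (Cons m w)
  have m: "m \<in> bas (MI p :: (pb \<times> pb,'f) bimod)" and w': "w \<in> words (MI p :: (pb \<times> pb,'f) bimod) (n - 1)"
    using Cons.prems by (auto simp: words_def)
  have w: "fin_supp (dword (MI p) w :: _ \<Rightarrow> 'f)" by (rule Cons.IH[OF w'])
  show "fin_supp (dword (MI p) (m # w) :: _ \<Rightarrow> 'f)"
    using m w by (simp add: dword_Cons[OF fin_supp_MI_dg] fin_supp_MI_dg)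
qed

lemma zigzag_d_cons_lin_left_mono:
  "lin_ext (zigzag_d p) (cons_lin (r,a,b) (lin_ext (left_mono \<beta>) v)) = fscale (ksign (int a))
     ((if r < p then cons_lin (Suc r, Suc a, b) (lin_ext (\<lambda>u. lin_ext left_xi (left_mono \<beta> u)) v)
        + (if b = 0 then cons_lin (Suc r, a, 1) (lin_ext (\<lambda>u. lin_ext left_x (left_mono \<beta> u)) v) else 0) else 0)
      + cons_lin (r,a,b) (lin_ext (\<lambda>u. lin_ext (zigzag_d p) (left_mono \<beta> u)) v))" if "fin_supp v"
  using that by (simp add: lin_ext_zigzag_d_cons_lin lin_ext_comp)

text \<open>The differential of the first pair becomes that of the first junction. For the later
  junctions the Koszul sign of the pair splits as the sign of its left factor, present in
  \<open>zigzag_d\<close>, times the sign from passing the right factor.\<close>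

lemma contract_dword:
  assumes "w \<in> words (MI p :: (pb \<times> pb,'f::field) bimod) n"
  shows "lin_ext contract (dword (MI p) w) = (lin_ext (zigzag_d p) (contract w) :: pb list \<Rightarrow> 'f::field)"
  using assms
proof (induction w arbitrary: n)
  case Nil
  show "lin_ext contract (dword (MI p) []) = (lin_ext (zigzag_d p) (contract []) :: pb list \<Rightarrow> 'f)" by (rule ext) simp
next
  case (Cons m w)
  obtain r a b r' a' b' where m: "m = ((r,a,b),(r',a',b'))" by (metis surj_pair)
  have mb: "m \<in> bas (MI p :: (pb \<times> pb,'f) bimod)" and w: "w \<in> words (MI p :: (pb \<times> pb,'f) bimod) (n - 1)"
    using Cons.prems by (auto simp: words_def)
  have IH: "lin_ext contract (dword (MI p) w) = (lin_ext (zigzag_d p) (contract w) :: pb list \<Rightarrow> 'f)" by (rule Cons.IH[OF w])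
  have kd: "kd (MI p :: (pb \<times> pb,'f) bimod) m = int a + int a'" by (simp add: m maltinvM_def pb_k_def)
  have xx: "lin_ext (\<lambda>u. lin_ext left_xi (left_mono (r',a',b') u)) (contract w) = (if b' = 0 then lin_ext (left_mono (r',a',1)) (contract w) else 0 :: pb list \<Rightarrow> 'f)"
    by (auto simp: left_xi_left_mono[symmetric, simplified] left_xi_left_mono_0)
  have x: "lin_ext (\<lambda>u. lin_ext left_x (left_mono (r',a',b') u)) (contract w) = (lin_ext (left_mono (r',Suc a',b')) (contract w) :: pb list \<Rightarrow> 'f)"
    by (simp only: left_x_left_mono[symmetric])
  have d: "lin_ext (\<lambda>u. lin_ext (zigzag_d p) (left_mono (r',a',b') u)) (contract w) =
     (fscale (ksign (int a')) (lin_ext (left_mono (r',a',b')) (lin_ext (zigzag_d p) (contract w))) :: pb list \<Rightarrow> 'f)"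
    by (simp add: zigzag_d_left_mono lin_ext_fun_fscale lin_ext_comp)
  have "lin_ext contract (dword (MI p) (m # w)) =
      lin_ext contract (lin_ext (\<lambda>m'. ind (m' # w)) (dg (MI p) m)) + fscale (ksign (int a + int a')) (cons_lin (r,a,b) (lin_ext (left_mono (r',a',b')) (lin_ext (zigzag_d p) (contract w) :: pb list \<Rightarrow> 'f)))"
    using fin_supp_MI_dg[OF mb] fin_supp_dword[OF w]
    by (simp add: dword_Cons lin_ext_add lin_ext_fscale kd) (simp add: m lin_ext_contract_cons_lin IH)
  also have "lin_ext contract (lin_ext (\<lambda>m'. ind (m' # w)) (dg (MI p) m)) = (fscale (ksign (int a))
      (if r < p then cons_lin (Suc r,Suc a,b) (if b' = 0 then lin_ext (left_mono (r',a',1)) (contract w) else 0)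
         + (if b = 0 then cons_lin (Suc r,a,1) (lin_ext (left_mono (r',Suc a',b')) (contract w)) else 0) else 0) :: pb list \<Rightarrow> 'f)"
    unfolding m using mb[unfolded m]
    by (cases "r < p"; cases "b = 0"; cases "b' = 0") (auto simp: MI_dg lin_ext_fscale lin_ext_add)
  also have "\<dots> + fscale (ksign (int a + int a')) (cons_lin (r,a,b) (lin_ext (left_mono (r',a',b')) (lin_ext (zigzag_d p) (contract w)))) =
     lin_ext (zigzag_d p) (contract (m # w))"
    by (simp add: m zigzag_d_cons_lin_left_mono xx x d cons_lin_fscale fscale_add ksign_add)
  finally show "lin_ext contract (dword (MI p) (m # w)) = (lin_ext (zigzag_d p) (contract (m # w)) :: pb list \<Rightarrow> 'f)" .
qed

lemma words_ConsD: "m # w \<in> words M n \<Longrightarrow> m \<in> bas M \<and> w \<in> words M (n - 1)"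
  by (auto simp: words_def)

text \<open>At the first junction this is associativity, (beta psi) alpha' = beta (psi alpha'); a
  later junction is reached by peeling off pairs. Finite supports are carried along for the
  composition of linear extensions.\<close>

lemma contract_rel:
  assumes "w \<in> words (MI p :: (pb \<times> pb,'f::field) bimod) n" "Suc i < n" "\<psi> \<in> PB p"
  shows "fin_supp (subst_at w i (ract (MI p :: (pb \<times> pb,'f) bimod) (w ! i) \<psi>)) \<and>
     fin_supp (subst_at w (Suc i) (lact (MI p :: (pb \<times> pb,'f) bimod) \<psi> (w ! Suc i))) \<and>
     lin_ext contract (subst_at w i (ract (MI p :: (pb \<times> pb,'f) bimod) (w ! i) \<psi>)) =
     (lin_ext contract (subst_at w (Suc i) (lact (MI p :: (pb \<times> pb,'f) bimod) \<psi> (w ! Suc i))) :: pb list \<Rightarrow> 'f)"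
  using assms(1,2)
proof (induction i arbitrary: w n)
  case 0
  then obtain \<alpha> \<beta> \<alpha>' \<beta>' w' where w: "w = (\<alpha>,\<beta>) # (\<alpha>',\<beta>') # w'"
    by (cases w; cases "tl w") (auto simp: words_def)
  have b: "(\<alpha>,\<beta>) \<in> bas (MI p :: (pb \<times> pb,'f) bimod)" "(\<alpha>',\<beta>') \<in> bas (MI p :: (pb \<times> pb,'f) bimod)"
    using 0 by (auto simp: w words_def)
  have r: "ract (MI p :: (pb \<times> pb,'f) bimod) (\<alpha>,\<beta>) \<psi> = (case pb_mult \<beta> \<psi> of None \<Rightarrow> 0 | Some \<delta> \<Rightarrow> ind (\<alpha>,\<delta>))"
    by (rule MI_ract[OF b(1) assms(3)])
  have l: "lact (MI p :: (pb \<times> pb,'f) bimod) \<psi> (\<alpha>',\<beta>') = (case pb_mult \<psi> \<alpha>' of None \<Rightarrow> 0 | Some \<gamma> \<Rightarrow> ind (\<gamma>,\<beta>'))"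
    by (rule MI_lact[OF b(2) assms(3)])
  have f: "fin_supp (ract (MI p :: (pb \<times> pb,'f) bimod) (\<alpha>,\<beta>) \<psi>)" "fin_supp (lact (MI p :: (pb \<times> pb,'f) bimod) \<psi> (\<alpha>',\<beta>'))"
    unfolding r l by (auto split: option.split)
  define X :: "pb list \<Rightarrow> 'f" where "X = lin_ext (left_mono \<beta>') (contract w')"
  have X: "fin_supp X" by (simp add: X_def)
  have "lin_ext contract (subst_at w 0 (ract (MI p :: (pb \<times> pb,'f) bimod) (w ! 0) \<psi>)) =
     (case pb_mult \<beta> \<psi> of None \<Rightarrow> 0 | Some \<delta> \<Rightarrow> cons_lin \<alpha> (lin_ext (left_mono \<delta>) (cons_lin \<alpha>' X)))"
    using f by (auto simp: w subst_at_0 r X_def split: option.split)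
  also have "\<dots> = (case (case pb_mult \<beta> \<psi> of None \<Rightarrow> None | Some \<delta> \<Rightarrow> pb_mult \<delta> \<alpha>') of None \<Rightarrow> 0 | Some \<epsilon> \<Rightarrow> cons_lin \<alpha> (cons_lin \<epsilon> X))"
    by (auto simp: lin_ext_left_mono_cons_lin[OF X] split: option.split)
  also have "\<dots> = (case (case pb_mult \<psi> \<alpha>' of None \<Rightarrow> None | Some \<delta> \<Rightarrow> pb_mult \<beta> \<delta>) of None \<Rightarrow> 0 | Some \<epsilon> \<Rightarrow> cons_lin \<alpha> (cons_lin \<epsilon> X))"
    unfolding pb_mult_assoc ..
  also have "\<dots> = (case pb_mult \<psi> \<alpha>' of None \<Rightarrow> 0 | Some \<gamma> \<Rightarrow> cons_lin \<alpha> (lin_ext (left_mono \<beta>) (cons_lin \<gamma> X)))"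
    by (auto simp: lin_ext_left_mono_cons_lin[OF X] split: option.split)
  also have "\<dots> = lin_ext contract (subst_at w (Suc 0) (lact (MI p :: (pb \<times> pb,'f) bimod) \<psi> (w ! Suc 0)))"
    using f by (auto simp: w subst_at_Suc subst_at_0 l X_def split: option.split)
  finally show ?case using f by (simp add: w subst_at_0 subst_at_Suc)
next
  case (Suc i)
  then obtain m w' where w: "w = m # w'" by (cases w) (auto simp: words_def)
  have "w' \<in> words (MI p :: (pb \<times> pb,'f) bimod) (n - 1)" using words_ConsD[OF Suc.prems(1)[unfolded w]] by simp
  moreover have "Suc i < n - 1" using Suc.prems by simp
  ultimately show ?case
    using Suc.IH[of w' "n - 1"] by (cases m) (simp add: w subst_at_Suc lin_ext_contract_cons_lin)
qed

lemma fin_supp_diff [simp]: "fin_supp u \<Longrightarrow> fin_supp v \<Longrightarrow> fin_supp (u - v)"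
  unfolding fin_supp_def by (rule finite_subset[of _ "{x. u x \<noteq> 0} \<union> {x. v x \<noteq> 0}"]) auto

lemma lin_ext_diff: "fin_supp u \<Longrightarrow> fin_supp v \<Longrightarrow> lin_ext f (u - v) = lin_ext f u - lin_ext f v"
  using lin_ext_add[of "u - v" v f] by simp

lemma subspace_ker: "fvs.subspace {v. fin_supp v \<and> lin_ext f v = 0}"
  by (auto simp: fvs.subspace_def lin_ext_add lin_ext_fscale)

lemma contract_R:
  assumes "r \<in> fspan (rels p (MI p :: (pb \<times> pb,'f::field) bimod) n)"
  shows "fin_supp r" "lin_ext contract r = 0"
proof -
  have "fspan (rels p (MI p :: (pb \<times> pb,'f) bimod) n) \<subseteq> {v. fin_supp v \<and> lin_ext contract v = 0}"
  proof (rule fvs.span_minimal[OF _ subspace_ker], safe)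
    fix v assume "v \<in> rels p (MI p :: (pb \<times> pb,'f) bimod) n"
    then obtain w i \<psi> where v: "v = subst_at w i (ract (MI p) (w ! i) \<psi>) - subst_at w (Suc i) (lact (MI p) \<psi> (w ! Suc i))"
      and h: "w \<in> words (MI p :: (pb \<times> pb,'f) bimod) n" "Suc i < n" "\<psi> \<in> PB p"
      by (auto simp: rels_def)
    show "fin_supp v" "lin_ext contract v = 0" unfolding v using contract_rel[OF h] by (simp_all add: lin_ext_diff)
  qed
  then show "fin_supp r" "lin_ext contract r = 0" using assms by blast+
qed

text \<open>A section of \<^term>\<open>contract\<close>: all right factors but the last are idempotents.\<close>

fun expand :: "pb list \<Rightarrow> (pb \<times> pb) list" where
  "expand (\<alpha> # \<beta> # \<gamma> # v) = (\<alpha>, (pb_li \<beta>,0,0)) # expand (\<beta> # \<gamma> # v)"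
| "expand [\<alpha>,\<beta>] = [(\<alpha>,\<beta>)]"
| "expand v = []"

text \<open>The first letter enters only the left factor of the first pair, so multiplying it on the
  left leaves the rest of the normal form unchanged.\<close>

lemma expand_Cons: "v \<noteq> [] \<Longrightarrow> \<exists>\<epsilon> W. \<forall>\<gamma>. expand (\<gamma> # v) = (\<gamma>,\<epsilon>) # W"
  by (cases v; cases "tl v") auto

lemma pb_mult_unit_right: "\<beta> \<in> PB p \<Longrightarrow> pb_mult (pb_li \<beta>,0,0) \<beta> = Some \<beta>"
  by (cases \<beta>) (simp add: pb_mult_def pb_li_def PB_def)

lemma unit_PB: "\<beta> \<in> PB p \<Longrightarrow> (pb_li \<beta>,0,0) \<in> PB p"
  by (auto simp: PB_def pb_li_def)

lemma zigzag_Cons: "zigzag p l (\<alpha> # w) \<longleftrightarrow> \<alpha> \<in> PB p \<and> pb_li \<alpha> = l \<and> zigzag p (p + 1 - pb_ri \<alpha>) w"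
  by (cases \<alpha>) (auto simp: PB_def pb_li_def pb_ri_def)

lemma pb_ri_PB: "\<alpha> \<in> PB p \<Longrightarrow> 1 \<le> pb_ri \<alpha> \<and> pb_ri \<alpha> \<le> p"
  by (auto simp: PB_def pb_ri_def)

lemma expand_words: "zigzag p l u \<Longrightarrow> length u = Suc (Suc n) \<Longrightarrow>
    expand u \<in> words (MI p :: (pb \<times> pb,'f::field) bimod) (Suc n) \<and> contract (expand u) = (ind u :: pb list \<Rightarrow> 'f)"
proof (induction u arbitrary: l n rule: expand.induct)
  case (1 \<alpha> \<beta> \<gamma> v)
  then obtain n' where n: "n = Suc n'" by (cases n) auto
  have ab: "\<alpha> \<in> PB p" "\<beta> \<in> PB p" "pb_li \<beta> = p + 1 - pb_ri \<alpha>" "zigzag p (pb_li \<beta>) (\<beta> # \<gamma> # v)"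
    using 1(2) by (simp_all add: zigzag_Cons)
  have len: "length (\<beta> # \<gamma> # v) = Suc (Suc n')" using 1(3) n by simp
  have IH: "expand (\<beta> # \<gamma> # v) \<in> words (MI p :: (pb \<times> pb,'f) bimod) (Suc n')"
    "contract (expand (\<beta> # \<gamma> # v)) = (ind (\<beta> # \<gamma> # v) :: pb list \<Rightarrow> 'f)"
    using 1(1)[OF ab(4) len] by simp_all
  have "pb_li (pb_li \<beta>,0,0) = pb_li \<beta>" by (simp add: pb_li_def)
  then have "pb_ri \<alpha> + pb_li (pb_li \<beta>,0,0) = p + 1"
    using ab(3) pb_ri_PB[OF ab(1)] by simp
  then have "(\<alpha>, (pb_li \<beta>,0,0)) \<in> bas (MI p :: (pb \<times> pb,'f) bimod)"
    using ab(1) unit_PB[OF ab(2)] by (simp add: MI_bas_iff)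
  then show ?case using IH pb_mult_unit_right[OF ab(2)] by (simp add: n words_Cons)
next
  case (2 \<alpha> \<beta>)
  have ab: "\<alpha> \<in> PB p" "\<beta> \<in> PB p" "pb_li \<beta> = p + 1 - pb_ri \<alpha>"
    using 2(1) by (simp_all add: zigzag_Cons)
  then have "(\<alpha>,\<beta>) \<in> bas (MI p :: (pb \<times> pb,'f) bimod)" using pb_ri_PB[OF ab(1)] by (simp add: MI_bas_iff)
  then show ?case using 2(2) by (simp add: words_def)
qed auto

lemma pb_mult_PB: "\<beta> \<in> PB p \<Longrightarrow> \<gamma> \<in> PB p \<Longrightarrow> pb_mult \<beta> \<gamma> = Some \<delta> \<Longrightarrow> \<delta> \<in> PB p"
  by (auto simp: PB_def pb_mult_def split: if_splits)

lemma pb_mult_deg: "pb_mult \<beta> \<gamma> = Some \<delta> \<Longrightarrow> fst (snd \<delta>) = fst (snd \<beta>) + fst (snd \<gamma>) \<and> snd (snd \<delta>) = snd (snd \<beta>) + snd (snd \<gamma>)"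
  by (auto simp: pb_mult_def split: if_splits prod.splits)

lemma cons_lin_nzD: "cons_lin a v u \<noteq> 0 \<Longrightarrow> \<exists>u'. u = a # u' \<and> v u' \<noteq> 0"
  by (cases u) (auto split: if_splits)

lemma lin_ext_nzD: "lin_ext f v u \<noteq> 0 \<Longrightarrow> \<exists>x. v x \<noteq> 0 \<and> f x u \<noteq> 0"
  using lin_ext_nz[of f v] by blast

text \<open>Each monomial contributes its number of xi to j + k, and each pair carries the shift by
  -1; this is the source of the summand n.\<close>

lemma contract_supp:
  assumes "w \<in> words (MI p :: (pb \<times> pb,'f::field) bimod) n" "w \<noteq> []" "contract w u \<noteq> (0 :: 'f)"
  shows "length u = Suc n \<and> zigzag p (pb_li (fst (hd w))) u \<and> pb_ri (last u) = pb_ri (snd (last w)) \<and>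
     int (x_count u) = (\<Sum>m\<leftarrow>w. kd (MI p :: (pb \<times> pb,'f) bimod) m) \<and>
     int (xi_count u) = (\<Sum>m\<leftarrow>w. jd (MI p :: (pb \<times> pb,'f) bimod) m) + (\<Sum>m\<leftarrow>w. kd (MI p :: (pb \<times> pb,'f) bimod) m) + int n"
  using assms
proof (induction w arbitrary: n u)
  case (Cons m w)
  obtain \<alpha> \<beta> where m: "m = (\<alpha>,\<beta>)" by (cases m)
  have mb: "(\<alpha>,\<beta>) \<in> bas (MI p :: (pb \<times> pb,'f) bimod)" and w: "w \<in> words (MI p :: (pb \<times> pb,'f) bimod) (n - 1)"
    using words_ConsD[OF Cons.prems(1)] by (simp_all add: m)
  have n: "n = Suc (length w)" using Cons.prems(1) by (simp add: words_def)
  have ab: "\<alpha> \<in> PB p" "\<beta> \<in> PB p" "p + 1 - pb_ri \<alpha> = pb_li \<beta>" using mb by (auto simp: MI_bas_iff)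
  have jk: "jd (MI p :: (pb \<times> pb,'f) bimod) (\<alpha>,\<beta>) = pb_j \<alpha> + pb_j \<beta> - 1"
    "kd (MI p :: (pb \<times> pb,'f) bimod) (\<alpha>,\<beta>) = pb_k \<alpha> + pb_k \<beta>" by (simp_all add: maltinvM_def)
  have deg: "pb_k \<gamma> = int (fst (snd \<gamma>))" "pb_j \<gamma> = int (snd (snd \<gamma>)) - int (fst (snd \<gamma>))" for \<gamma>
    by (cases \<gamma>; simp add: pb_k_def pb_j_def)+
  obtain u1 where u: "u = \<alpha> # u1" and u1: "lin_ext (left_mono \<beta>) (contract w) u1 \<noteq> (0 :: 'f)"
    using cons_lin_nzD[OF Cons.prems(3)[unfolded m contract.simps]] by (elim exE conjE)
  show ?case
  proof (cases w)
    case Nil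
    then have "u1 = [\<beta>]" using u1 by (simp add: ind_eq_0)
    then show ?thesis using ab n by (simp add: u m Nil zigzag_Cons jk deg)
  next
    case (Cons m' w')
    obtain u2 where u2: "contract w u2 \<noteq> (0 :: 'f)" "left_mono \<beta> u2 u1 \<noteq> (0 :: 'f)"
      using lin_ext_nzD[OF u1] by (elim exE conjE)
    have IH: "length u2 = Suc (n - 1)" "zigzag p (pb_li (fst (hd w))) u2" "pb_ri (last u2) = pb_ri (snd (last w))"
     "int (x_count u2) = (\<Sum>m\<leftarrow>w. kd (MI p :: (pb \<times> pb,'f) bimod) m)"
     "int (xi_count u2) = (\<Sum>m\<leftarrow>w. jd (MI p :: (pb \<times> pb,'f) bimod) m) + (\<Sum>m\<leftarrow>w. kd (MI p :: (pb \<times> pb,'f) bimod) m) + int (n - 1)"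
      using Cons.IH[OF w _ u2(1)] Cons by simp_all
    obtain \<gamma> v where g: "u2 = \<gamma> # v" using IH(1) by (cases u2) auto
    obtain \<delta> where d: "pb_mult \<beta> \<gamma> = Some \<delta>" "u1 = \<delta> # v"
      using u2(2) by (auto simp: g ind_eq_0 split: option.splits)
    have gp: "\<gamma> \<in> PB p" "zigzag p (p + 1 - pb_ri \<gamma>) v" using IH(2) by (auto simp: g zigzag_Cons)
    have "zigzag p (p + 1 - pb_ri \<alpha>) (\<delta> # v)"
      using pb_mult_PB[OF ab(2) gp(1) d(1)] pb_mult_li[OF d(1)] pb_mult_ri[OF d(1)] gp ab by (simp add: zigzag_Cons)
    moreover have "pb_ri (last (\<delta> # v)) = pb_ri (last (\<gamma> # v))" using pb_mult_ri[OF d(1)] by simp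
    ultimately show ?thesis
      using IH(1,3,4,5) ab n Cons pb_mult_deg[OF d(1)] by (simp add: u m d(2) g zigzag_Cons[of p _ \<alpha>] jk deg)
  qed
qed simp

lemma rels_cons_lin:
  assumes "m \<in> bas M" "r \<in> rels p M n"
  shows "cons_lin m r \<in> rels p M (Suc n)"
proof -
  obtain w i \<psi> where "r = subst_at w i (ract M (w ! i) \<psi>) - subst_at w (Suc i) (lact M \<psi> (w ! Suc i))"
    and h: "w \<in> words M n" "Suc i < n" "\<psi> \<in> PB p"
    using assms(2) by (auto simp: rels_def)
  then have "cons_lin m r = subst_at (m # w) (Suc i) (ract M ((m # w) ! Suc i) \<psi>)
      - subst_at (m # w) (Suc (Suc i)) (lact M \<psi> ((m # w) ! Suc (Suc i)))"
    by (simp add: subst_at_Suc cons_lin_diff)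
  moreover have "m # w \<in> words M (Suc n)" "Suc (Suc i) < Suc n" using h assms(1) by (simp_all add: words_Cons)
  ultimately show ?thesis unfolding rels_def using h(3) by blast
qed

lemma span_rels_cons_lin:
  assumes "m \<in> bas M" "r \<in> fspan (rels p M n)"
  shows "cons_lin m r \<in> fspan (rels p M (Suc n))"
proof -
  have "fspan (rels p M n) \<subseteq> {v. cons_lin m v \<in> fspan (rels p M (Suc n))}"
  proof (rule fvs.span_minimal)
    show "fvs.subspace {v. cons_lin m v \<in> fspan (rels p M (Suc n))}"
      by (auto simp: fvs.subspace_def cons_lin_add cons_lin_fscale fvs.span_zero fvs.span_add fvs.span_scale)
  qed (use rels_cons_lin[OF assms(1)] in \<open>auto intro: fvs.span_base\<close>)
  then show ?thesis using assms(2) by blast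
qed

text \<open>This is the relation that moves psi = beta across the first tensor sign of the word with
  a unit in place of beta: acting on the unit it gives beta, acting to the right it gives beta
  gamma.\<close>

lemma rel_at_0:
  assumes "(\<alpha>,\<beta>) \<in> bas (MI p :: (pb \<times> pb,'f::field) bimod)" "zigzag p l (\<gamma> # v)" "length v = Suc n"
  shows "ind ((\<alpha>,\<beta>) # expand (\<gamma> # v)) - (case pb_mult \<beta> \<gamma> of None \<Rightarrow> 0 | Some \<delta> \<Rightarrow> ind (expand (\<alpha> # \<delta> # v)))
    \<in> rels p (MI p :: (pb \<times> pb,'f) bimod) (Suc (Suc n))"
proof -
  have ab: "\<alpha> \<in> PB p" "\<beta> \<in> PB p" "pb_ri \<alpha> + pb_li \<beta> = p + 1" using assms(1) by (simp_all add: MI_bas_iff)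
  obtain \<epsilon> W where W: "\<And>\<gamma>. expand (\<gamma> # v) = (\<gamma>,\<epsilon>) # W" using expand_Cons[of v] assms(3) by (cases v) auto
  obtain \<eta> v' where v: "v = \<eta> # v'" using assms(3) by (cases v) auto
  have sgw: "expand (\<gamma> # v) \<in> words (MI p :: (pb \<times> pb,'f) bimod) (Suc n)"
    by (rule expand_words[THEN conjunct1, OF assms(2)]) (simp add: assms(3))
  then have g: "(\<gamma>,\<epsilon>) \<in> bas (MI p :: (pb \<times> pb,'f) bimod)" unfolding W by (simp add: words_Cons)
  let ?e = "(pb_li \<beta>,0,0)"
  have "pb_li ?e = pb_li \<beta>" by (simp add: pb_li_def)
  then have e: "(\<alpha>,?e) \<in> bas (MI p :: (pb \<times> pb,'f) bimod)" using ab(1,3) unit_PB[OF ab(2)] by (simp add: MI_bas_iff)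
  let ?w = "(\<alpha>,?e) # expand (\<gamma> # v)"
  have r: "ract (MI p :: (pb \<times> pb,'f) bimod) (?w ! 0) \<beta> = ind (\<alpha>,\<beta>)"
    using MI_ract[OF e ab(2)] pb_mult_unit_right[OF ab(2)] by simp
  have l: "lact (MI p :: (pb \<times> pb,'f) bimod) \<beta> (?w ! Suc 0) = (case pb_mult \<beta> \<gamma> of None \<Rightarrow> 0 | Some \<delta> \<Rightarrow> ind (\<delta>,\<epsilon>))"
    using MI_lact[OF g ab(2)] by (simp add: W)
  have 0: "subst_at ?w 0 (ind (\<alpha>,\<beta>)) = (ind ((\<alpha>,\<beta>) # expand (\<gamma> # v)) :: _ \<Rightarrow> 'f)"
    by (simp add: subst_at_0)
  have "expand (\<alpha> # \<delta> # v) = (\<alpha>,?e) # (\<delta>,\<epsilon>) # W" if "pb_mult \<beta> \<gamma> = Some \<delta>" for \<delta>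
    using W[of \<delta>] pb_mult_li[OF that] by (simp add: v)
  then have 1: "subst_at ?w (Suc 0) (case pb_mult \<beta> \<gamma> of None \<Rightarrow> 0 | Some \<delta> \<Rightarrow> ind (\<delta>,\<epsilon>)) =
    ((case pb_mult \<beta> \<gamma> of None \<Rightarrow> 0 | Some \<delta> \<Rightarrow> ind (expand (\<alpha> # \<delta> # v))) :: _ \<Rightarrow> 'f)"
    by (auto simp: subst_at_Suc W subst_at_0 split: option.split)
  have "?w \<in> words (MI p :: (pb \<times> pb,'f) bimod) (Suc (Suc n))" using e sgw by (simp add: words_Cons)
  then have "subst_at ?w 0 (ract (MI p :: (pb \<times> pb,'f) bimod) (?w ! 0) \<beta>)
      - subst_at ?w (Suc 0) (lact (MI p :: (pb \<times> pb,'f) bimod) \<beta> (?w ! Suc 0)) \<in> rels p (MI p :: (pb \<times> pb,'f) bimod) (Suc (Suc n))"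
    unfolding rels_def using ab(2) by blast
  then show ?thesis unfolding r l 0 1 .
qed

abbreviation lift_expand :: "(pb list \<Rightarrow> 'f::field) \<Rightarrow> (pb \<times> pb) list \<Rightarrow> 'f" where
  "lift_expand \<equiv> lin_ext (\<lambda>u. ind (expand u))"

lemma lin_ext_fun_diff: "lin_ext (\<lambda>x. f x - g x) v = lin_ext f v - lin_ext g v"
  by (auto simp: lin_ext_def right_diff_distrib sum_subtractf)

text \<open>Every word equals its normal form modulo R: the tail is normalised by induction and then
  absorbs beta by \<open>rel_at_0\<close>. Hence the kernel of the contraction lies in R.\<close>

lemma lift_expand_contract:
  assumes "w \<in> words (MI p :: (pb \<times> pb,'f::field) bimod) (Suc n)"
  shows "ind w - lift_expand (contract w) \<in> fspan (rels p (MI p :: (pb \<times> pb,'f) bimod) (Suc n))"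
  using assms
proof (induction n arbitrary: w)
  case 0
  then obtain \<alpha> \<beta> where "w = [(\<alpha>,\<beta>)]" by (cases w; cases "tl w") (auto simp: words_def)
  then have "ind w - lift_expand (contract w) = (0 :: _ \<Rightarrow> 'f)" by simp
  then show ?case by (simp only: fvs.span_zero)
next
  case (Suc n)
  obtain \<alpha> \<beta> w' where w: "w = (\<alpha>,\<beta>) # w'" using Suc.prems by (cases w) (auto simp: words_def)
  have m: "(\<alpha>,\<beta>) \<in> bas (MI p :: (pb \<times> pb,'f) bimod)" and w': "w' \<in> words (MI p :: (pb \<times> pb,'f) bimod) (Suc n)"
    using Suc.prems by (simp_all add: w words_Cons)
  have 1: "cons_lin (\<alpha>,\<beta>) (ind w' - lift_expand (contract w')) \<in> fspan (rels p (MI p :: (pb \<times> pb,'f) bimod) (Suc (Suc n)))"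
    by (rule span_rels_cons_lin[OF m Suc.IH[OF w']])
  have 2: "lin_ext (\<lambda>u. ind ((\<alpha>,\<beta>) # expand u) - lift_expand (cons_lin \<alpha> (left_mono \<beta> u))) (contract w') \<in> fspan (rels p (MI p :: (pb \<times> pb,'f) bimod) (Suc (Suc n)))"
  proof (rule lin_ext_in_span)
    fix u assume nz: "contract w' u \<noteq> (0 :: 'f)"
    have "w' \<noteq> []" using w' by (auto simp: words_def)
    then have u: "length u = Suc (Suc n)" "zigzag p (pb_li (fst (hd w'))) u"
      using contract_supp[OF w' _ nz] by simp_all
    then obtain \<gamma> v where g: "u = \<gamma> # v" "length v = Suc n" by (cases u) auto
    have "lift_expand (cons_lin \<alpha> (left_mono \<beta> u)) = ((case pb_mult \<beta> \<gamma> of None \<Rightarrow> 0 | Some \<delta> \<Rightarrow> ind (expand (\<alpha> # \<delta> # v))) :: _ \<Rightarrow> 'f)"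
      by (auto simp: g split: option.split)
    then show "ind ((\<alpha>,\<beta>) # expand u) - lift_expand (cons_lin \<alpha> (left_mono \<beta> u)) \<in> fspan (rels p (MI p :: (pb \<times> pb,'f) bimod) (Suc (Suc n)))"
      using rel_at_0[OF m u(2)[unfolded g] g(2)] by (simp only: g fvs.span_base)
  qed
  have 3: "lift_expand (contract w) = lin_ext (\<lambda>u. lift_expand (cons_lin \<alpha> (left_mono \<beta> u))) (contract w' :: _ \<Rightarrow> 'f)"
    unfolding w contract.simps lin_ext_cons_lin by (rule lin_ext_comp) simp_all
  have 4: "ind w - lift_expand (contract w) = cons_lin (\<alpha>,\<beta>) (ind w' - lift_expand (contract w')) + lin_ext (\<lambda>u. ind ((\<alpha>,\<beta>) # expand u) - lift_expand (cons_lin \<alpha> (left_mono \<beta> u))) (contract w' :: _ \<Rightarrow> 'f)"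
    unfolding 3 unfolding lin_ext_fun_diff cons_lin_diff cons_lin_ind cons_lin_lin_ext w by simp
  show "ind w - lift_expand (contract w) \<in> fspan (rels p (MI p :: (pb \<times> pb,'f) bimod) (Suc (Suc n)))"
    unfolding 4 by (rule fvs.span_add[OF 1 2])
qed

section \<open>Relations and differential stay within the space of words\<close>

lemma subst_at_words:
  assumes "w \<in> words M n" "i < n" "\<And>m. c m \<noteq> 0 \<Longrightarrow> m \<in> bas M" "subst_at w i c v \<noteq> 0"
  shows "v \<in> words M n"
proof -
  have v: "length v = length w" "\<And>j. j < length w \<Longrightarrow> j \<noteq> i \<Longrightarrow> v ! j = w ! j" "c (v ! i) \<noteq> 0"
    using assms(4) by (auto simp: subst_at_def split: if_splits)
  have "v ! j \<in> bas M" if "j < length v" for j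
    using that v assms(1,3) by (cases "j = i") (auto simp: words_def)
  then show ?thesis using v(1) assms(1) by (auto simp: words_def in_set_conv_nth)
qed

lemma MI_bimod_bas:
  assumes "m \<in> bas (MI p :: (pb \<times> pb,'f::field) bimod)"
  shows "dg (MI p :: (pb \<times> pb,'f) bimod) m m' \<noteq> 0 \<Longrightarrow> m' \<in> bas (MI p :: (pb \<times> pb,'f) bimod)"
    and "\<psi> \<in> PB p \<Longrightarrow> lact (MI p :: (pb \<times> pb,'f) bimod) \<psi> m m' \<noteq> 0 \<Longrightarrow> m' \<in> bas (MI p :: (pb \<times> pb,'f) bimod)"
    and "\<psi> \<in> PB p \<Longrightarrow> ract (MI p :: (pb \<times> pb,'f) bimod) m \<psi> m' \<noteq> 0 \<Longrightarrow> m' \<in> bas (MI p :: (pb \<times> pb,'f) bimod)"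
proof -
  obtain \<alpha> \<beta> where m: "m = (\<alpha>,\<beta>)" by (cases m)
  obtain r a b r' a' b' where ab: "\<alpha> = (r,a,b)" "\<beta> = (r',a',b')" by (metis surj_pair)
  have mb: "(\<alpha>,\<beta>) \<in> bas (MI p :: (pb \<times> pb,'f) bimod)" using assms m by simp
  note mb' = mb[unfolded MI_bas_iff]
  show "m' \<in> bas (MI p :: (pb \<times> pb,'f) bimod)" if "dg (MI p :: (pb \<times> pb,'f) bimod) m m' \<noteq> 0"
  proof -
    have "r < p" using that MI_dg[OF mb[unfolded ab]] by (auto simp: m ab fscale_def split: if_splits)
    have "m' = ((Suc r,Suc a,b),(r',a',1)) \<and> b' = 0 \<or> m' = ((Suc r,a,1),(r',Suc a',b')) \<and> b = 0"
      using that MI_dg[OF mb[unfolded ab]] by (auto simp: m ab fscale_def ind_def split: if_splits)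
    then show ?thesis
      using mb[unfolded ab MI_bas] \<open>r < p\<close> by (elim disjE conjE; simp only: MI_bas) (auto simp: PB_def)
  qed
  show "m' \<in> bas (MI p :: (pb \<times> pb,'f) bimod)" if p: "\<psi> \<in> PB p" and nz: "lact (MI p :: (pb \<times> pb,'f) bimod) \<psi> m m' \<noteq> 0"
  proof -
    obtain \<gamma> where "pb_mult \<psi> \<alpha> = Some \<gamma>" "m' = (\<gamma>,\<beta>)"
      using nz MI_lact[OF mb p] by (auto simp: m ind_eq_0 split: option.splits)
    then show ?thesis using mb' pb_mult_ri[of \<psi> \<alpha> \<gamma>] pb_mult_PB[OF p, of \<alpha> \<gamma>] by (simp add: MI_bas_iff)
  qed
  show "m' \<in> bas (MI p :: (pb \<times> pb,'f) bimod)" if p: "\<psi> \<in> PB p" and nz: "ract (MI p :: (pb \<times> pb,'f) bimod) m \<psi> m' \<noteq> 0"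
  proof -
    obtain \<gamma> where "pb_mult \<beta> \<psi> = Some \<gamma>" "m' = (\<alpha>,\<gamma>)"
      using nz MI_ract[OF mb p] by (auto simp: m ind_eq_0 split: option.splits)
    then show ?thesis using mb' pb_mult_li[of \<beta> \<psi> \<gamma>] pb_mult_PB[of \<beta> p \<psi> \<gamma>] p by (simp add: MI_bas_iff)
  qed
qed

lemma rels_Vsp: "rels p (MI p :: (pb \<times> pb,'f::field) bimod) n \<subseteq> Vsp (MI p) n"
proof
  fix v assume "v \<in> rels p (MI p :: (pb \<times> pb,'f) bimod) n"
  then obtain w i \<psi> where v: "v = subst_at w i (ract (MI p) (w ! i) \<psi>) - subst_at w (Suc i) (lact (MI p) \<psi> (w ! Suc i))"
    and h: "w \<in> words (MI p :: (pb \<times> pb,'f) bimod) n" "Suc i < n" "\<psi> \<in> PB p"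
    by (auto simp: rels_def)
  have b: "w ! i \<in> bas (MI p :: (pb \<times> pb,'f) bimod)" "w ! Suc i \<in> bas (MI p :: (pb \<times> pb,'f) bimod)"
    using h(1,2) by (auto simp: words_def)
  have "subst_at w i (ract (MI p :: (pb \<times> pb,'f) bimod) (w ! i) \<psi>) u \<noteq> 0 \<Longrightarrow> u \<in> words (MI p :: (pb \<times> pb,'f) bimod) n" for u
    by (rule subst_at_words[OF h(1)]) (use h MI_bimod_bas(3)[OF b(1) h(3)] in simp_all)
  moreover have "subst_at w (Suc i) (lact (MI p :: (pb \<times> pb,'f) bimod) \<psi> (w ! Suc i)) u \<noteq> 0 \<Longrightarrow> u \<in> words (MI p :: (pb \<times> pb,'f) bimod) n" for u
    by (rule subst_at_words[OF h(1)]) (use h MI_bimod_bas(2)[OF b(2) h(3)] in simp_all)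
  moreover have "subst_at w i (ract (MI p) (w ! i) \<psi>) u \<noteq> (0 :: 'f) \<or> subst_at w (Suc i) (lact (MI p) \<psi> (w ! Suc i)) u \<noteq> (0 :: 'f)"
    if "v u \<noteq> 0" for u using that by (auto simp: v)
  ultimately show "v \<in> Vsp (MI p) n" unfolding Vsp_def by blast
qed

lemma dword_words:
  assumes "w \<in> words M n" "dword M w v \<noteq> 0" "\<And>m m'. m \<in> bas M \<Longrightarrow> dg M m m' \<noteq> 0 \<Longrightarrow> m' \<in> bas M"
  shows "v \<in> words M n"
proof -
  obtain i where i: "i < length w" "subst_at w i (dg M (w ! i)) v \<noteq> 0"
    using assms(2) by (auto simp: dword_def sum_fun_app fscale_def elim!: sum.not_neutral_contains_not_neutral)
  have wi: "w ! i \<in> bas M" "i < n" using assms(1) i by (auto simp: words_def)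
  show ?thesis by (rule subst_at_words[OF assms(1) wi(2) assms(3)[OF wi(1)] i(2)])
qed

lemma dlin_Vsp:
  fixes M :: "('b,'f::field) bimod"
  assumes "finite (bas M)" "\<And>m m'. m \<in> bas M \<Longrightarrow> dg M m m' \<noteq> 0 \<Longrightarrow> m' \<in> bas M"
  shows "dlin M n ` Vsp M n \<subseteq> Vsp M n"
proof safe
  fix v assume v: "v \<in> Vsp M n"
  have "u \<in> words M n" if nz: "lin_ext (dword M) v u \<noteq> 0" for u
  proof -
    obtain w where "v w \<noteq> 0" "dword M w u \<noteq> 0" using lin_ext_nzD[OF nz] by (elim exE conjE)
    then show ?thesis using dword_words[of w M n u] v assms(2) by (simp add: Vsp_def)
  qed
  then show "dlin M n v \<in> Vsp M n" unfolding dlin_lin_ext[OF assms(1) v] by (simp add: Vsp_def)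
qed

lemma dlin_MI: "dlin (MI p :: (pb \<times> pb,'f::field) bimod) n ` Vsp (MI p) n \<subseteq> Vsp (MI p) n"
  by (rule dlin_Vsp[OF finite_MI]) (rule MI_bimod_bas(1))

lemma hdim_maltinv:
  assumes p: "2 \<le> p" "s \<le> p" and n: "1 \<le> n"
  shows "hdim p (MI p :: (pb \<times> pb,'f::field) bimod) n s t j k \<le> 1"
proof (rule hdim_le_1[OF finite_MI rels_Vsp dlin_MI])
  let ?M = "MI p :: (pb \<times> pb,'f) bimod"
  let ?R = "fspan (rels p ?M n)" and ?V = "{v \<in> Vsp ?M n. \<forall>w. v w \<noteq> 0 \<longrightarrow> w \<in> words_deg ?M n s t j k}"
  let ?X = "cells p (Suc n) s t k (j + k + int n)" and ?Y = "cells p (Suc n) s t (k - 1) (j + k + int n - 1)"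
  fix z1 z2 assume z: "z1 \<in> fspan (?V \<union> ?R)" "z2 \<in> fspan (?V \<union> ?R)" "dlin ?M n z1 \<in> ?R" "dlin ?M n z2 \<in> ?R"
  have R_Vsp: "?R \<subseteq> Vsp ?M n" by (rule fvs.span_minimal[OF rels_Vsp subspace_Vsp])
  note fs = fin_supp_Vsp[OF finite_MI]
  \<comment> \<open>R contracts to zero, so adding it to the graded piece does not enlarge the set
    of reachable words.\<close>
  have sub: "fspan (?V \<union> ?R) \<subseteq> {z \<in> Vsp ?M n. \<forall>u. lin_ext contract z u \<noteq> 0 \<longrightarrow> u \<in> ?X}"
  proof (rule fvs.span_minimal)
    have "v \<in> Vsp ?M n \<and> (\<forall>u. lin_ext contract v u \<noteq> 0 \<longrightarrow> u \<in> ?X)" if "v \<in> ?V" for v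
    proof safe
      show "v \<in> Vsp ?M n" using that by blast
      fix u assume nz: "lin_ext contract v u \<noteq> 0"
      obtain w where w: "v w \<noteq> 0" "contract w u \<noteq> (0 :: 'f)" using lin_ext_nzD[OF nz] by (elim exE conjE)
      have "w \<in> words_deg ?M n s t j k" using that w(1) by simp
      then have wd: "w \<in> words ?M n" "w \<noteq> []" "pb_li (fst (hd w)) = s" "pb_ri (snd (last w)) = t"
        "(\<Sum>b\<leftarrow>w. jd ?M b) = j" "(\<Sum>b\<leftarrow>w. kd ?M b) = k"
        by (auto simp: words_deg_def maltinvM_def case_prod_unfold)
      show "u \<in> ?X" using contract_supp[OF wd(1,2) w(2)] wd(3-6) by (simp add: cells_def)
    qed
    then show "?V \<union> ?R \<subseteq> {z \<in> Vsp ?M n. \<forall>u. lin_ext contract z u \<noteq> 0 \<longrightarrow> u \<in> ?X}"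
      using R_Vsp contract_R(2) by fastforce
    show "fvs.subspace {z \<in> Vsp ?M n. \<forall>u. lin_ext contract z u \<noteq> 0 \<longrightarrow> u \<in> ?X}"
      unfolding fvs.subspace_def
    proof (safe)
      show "0 \<in> Vsp ?M n" by (rule fvs.subspace_0[OF subspace_Vsp])
      fix x y assume xy: "x \<in> Vsp ?M n" "y \<in> Vsp ?M n"
        "\<forall>u. lin_ext contract x u \<noteq> 0 \<longrightarrow> u \<in> ?X" "\<forall>u. lin_ext contract y u \<noteq> 0 \<longrightarrow> u \<in> ?X"
      show "x + y \<in> Vsp ?M n" by (rule fvs.subspace_add[OF subspace_Vsp xy(1,2)])
      fix u assume "lin_ext contract (x + y) u \<noteq> 0"
      then have "lin_ext contract x u \<noteq> 0 \<or> lin_ext contract y u \<noteq> 0"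
        by (auto simp: lin_ext_add[OF fs[OF xy(1)] fs[OF xy(2)]])
      then show "u \<in> ?X" using xy by blast
    next
      fix c x assume x: "x \<in> Vsp ?M n" "\<forall>u. lin_ext contract x u \<noteq> 0 \<longrightarrow> u \<in> ?X"
      show "fscale c x \<in> Vsp ?M n" by (rule fvs.subspace_scale[OF subspace_Vsp x(1)])
      fix u assume "lin_ext contract (fscale c x) u \<noteq> 0"
      then have "lin_ext contract x u \<noteq> 0" unfolding lin_ext_fscale by (auto simp: fscale_def)
      then show "u \<in> ?X" using x by blast
    qed (simp add: zero_fun_def[symmetric])
  qed
  have zV: "z1 \<in> Vsp ?M n" "z2 \<in> Vsp ?M n"
    and zX: "\<And>u. lin_ext contract z1 u \<noteq> 0 \<Longrightarrow> u \<in> ?X" "\<And>u. lin_ext contract z2 u \<noteq> 0 \<Longrightarrow> u \<in> ?X"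
    using sub z(1,2) by blast+
  have chain: "lin_ext (zigzag_d p) (lin_ext contract z) = lin_ext contract (dlin ?M n z)" if "z \<in> Vsp ?M n" for z
  proof -
    have w: "w \<in> words ?M n" if "z w \<noteq> 0" for w using that \<open>z \<in> Vsp ?M n\<close> by (simp add: Vsp_def)
    have "lin_ext (zigzag_d p) (lin_ext contract z) = lin_ext (\<lambda>w. lin_ext (zigzag_d p) (contract w)) z"
      by (rule lin_ext_comp) (simp_all add: fs[OF that])
    also have "\<dots> = lin_ext (\<lambda>w. lin_ext contract (dword ?M w)) z"
      by (rule lin_ext_cong) (simp add: contract_dword[OF w])
    also have "\<dots> = lin_ext contract (lin_ext (dword ?M) z)"
      by (rule lin_ext_comp[symmetric]) (simp_all add: fs[OF that] fin_supp_dword[OF w])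
    finally show ?thesis by (simp add: dlin_lin_ext[OF finite_MI that])
  qed
  have cyc: "lin_ext (zigzag_d p) (lin_ext contract z1) = 0" "lin_ext (zigzag_d p) (lin_ext contract z2) = 0"
    using chain zV z(3,4) contract_R(2) by simp_all
  obtain c1 c2 y where c: "c1 \<noteq> 0 \<or> c2 \<noteq> 0" and yY: "\<And>w. y w \<noteq> 0 \<Longrightarrow> w \<in> ?Y"
    and y: "fscale c1 (lin_ext contract z1) + fscale c2 (lin_ext contract z2) = lin_ext (zigzag_d p) y"
    using cells_cycles_dependent[OF p(1,2) _ zX(1) cyc(1) zX(2) cyc(2)] n by auto
  have fy: "fin_supp y" unfolding fin_supp_def
    by (rule finite_subset[OF _ finite_cells[of p "Suc n" s t "k - 1" "j + k + int n - 1"]]) (use yY in auto)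
  have sgy: "expand u \<in> words ?M n" "contract (expand u) = (ind u :: _ \<Rightarrow> 'f)" if "y u \<noteq> 0" for u
  proof -
    obtain n' where n': "n = Suc n'" using n by (cases n) auto
    have "zigzag p s u" "length u = Suc (Suc n')" using yY[OF that] by (simp_all add: cells_def n')
    then show "expand u \<in> words ?M n" "contract (expand u) = (ind u :: _ \<Rightarrow> 'f)" using expand_words n' by blast+
  qed
  \<comment> \<open>The bounding chain y is lifted by the section. The given combination and the
    boundary of the lift then have the same contraction.\<close>
  have lV: "lift_expand y \<in> Vsp ?M n"
    unfolding Vsp_def using sgy(1) by (auto dest!: lin_ext_nzD simp: ind_eq_0)
  have contract_lift_expand: "lin_ext contract (lift_expand y) = y"
  proof -
    have "lin_ext contract (lift_expand y) = lin_ext (\<lambda>u. contract (expand u)) y" using fy by (simp add: lin_ext_comp)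
    also have "\<dots> = lin_ext ind y" by (rule lin_ext_cong) (rule sgy(2))
    finally show ?thesis using fy by (simp add: lin_ext_ind_id)
  qed
  let ?c = "fscale c1 z1 + fscale c2 z2" and ?d = "dlin ?M n (lift_expand y)"
  have dV: "?d \<in> Vsp ?M n" using dlin_MI lV by blast
  have cV: "?c \<in> Vsp ?M n"
    by (intro fvs.subspace_add[OF subspace_Vsp] fvs.subspace_scale[OF subspace_Vsp] zV)
  have xV: "?c - ?d \<in> Vsp ?M n" by (rule fvs.subspace_diff[OF subspace_Vsp cV dV])
  have "lin_ext contract (?c - ?d) = 0"
    using y chain[OF lV] by (simp add: lin_ext_diff lin_ext_add lin_ext_fscale fs[OF zV(1)] fs[OF zV(2)] fs[OF dV] contract_lift_expand)
  \<comment> \<open>An element of V differs from the lift of its contraction by an element of R;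
    here the contraction is zero.\<close>
  moreover have "(?c - ?d) - lift_expand (lin_ext contract (?c - ?d)) \<in> ?R"
  proof -
    let ?x = "?c - ?d"
    obtain n' where n': "n = Suc n'" using n by (cases n) auto
    have "lin_ext (\<lambda>w. ind w - lift_expand (contract w)) ?x \<in> ?R"
      by (rule lin_ext_in_span) (use xV lift_expand_contract n' in \<open>auto simp: Vsp_def\<close>)
    moreover have "lin_ext (\<lambda>w. ind w - lift_expand (contract w)) ?x = ?x - lift_expand (lin_ext contract ?x)"
      using fs[OF xV] by (simp add: lin_ext_fun_diff lin_ext_ind_id lin_ext_comp)
    ultimately show ?thesis by simp
  qed
  ultimately have "?c - ?d \<in> ?R" by simp
  then have "(?c - ?d) + ?d \<in> fspan (dlin ?M n ` Vsp ?M n \<union> ?R)"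
    using lV by (intro fvs.span_add) (auto intro: fvs.span_base)
  then have "?c \<in> fspan (dlin ?M n ` Vsp ?M n \<union> ?R)" by simp
  then show "\<exists>c1 c2. (c1 \<noteq> 0 \<or> c2 \<noteq> 0) \<and> fscale c1 z1 + fscale c2 z2 \<in> fspan (dlin ?M n ` Vsp ?M n \<union> ?R)"
    using c by blast
qed

section \<open>Homological degrees zero and one\<close>

text \<open>With a single tensor factor there are no relations. \<open>morse\<close> is applied with
  Y empty, so targets count as critical too, and the cycles are dependent without help from
  boundaries.\<close>

lemma hdim_one:
  fixes M :: "('b,'f::field) bimod"
  assumes fin: "finite (bas M)" and dg: "\<And>m m'. m \<in> bas M \<Longrightarrow> dg M m m' \<noteq> 0 \<Longrightarrow> m' \<in> bas M"
    and m_nz: "\<And>u v. m u v \<Longrightarrow> dword M u v \<noteq> 0"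
    and m_fun: "\<And>u v v'. m u v \<Longrightarrow> m u v' \<Longrightarrow> v = v'"
    and m_tri: "\<And>u v u' v'. m u v \<Longrightarrow> m u' v' \<Longrightarrow> dword M u v' \<noteq> 0 \<Longrightarrow> u = u'"
    and crit: "\<And>x x'. x \<in> words_deg M 1 s t j k \<Longrightarrow> x' \<in> words_deg M 1 s t j k \<Longrightarrow>
      \<nexists>v. m x v \<Longrightarrow> \<nexists>v. m x' v \<Longrightarrow> x = x'"
  shows "hdim p M 1 s t j k \<le> 1"
proof (rule hdim_le_1[OF fin])
  have rels: "rels p M 1 = {}" by (auto simp: rels_def)
  show "rels p M 1 \<subseteq> Vsp M 1" unfolding rels by simp
  show "dlin M 1 ` Vsp M 1 \<subseteq> Vsp M 1" by (rule dlin_Vsp[OF fin dg])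
  let ?V = "{v \<in> Vsp M 1. \<forall>w. v w \<noteq> 0 \<longrightarrow> w \<in> words_deg M 1 s t j k}"
  let ?R = "fspan (rels p M 1)"
  fix z1 z2 assume z: "z1 \<in> fspan (?V \<union> ?R)" "z2 \<in> fspan (?V \<union> ?R)" "dlin M 1 z1 \<in> ?R" "dlin M 1 z2 \<in> ?R"
  have "?V = {v. \<forall>w. v w \<noteq> 0 \<longrightarrow> w \<in> words_deg M 1 s t j k}"
    by (auto simp: Vsp_def words_deg_def)
  then have "fvs.subspace ?V"
    by (simp add: fvs.subspace_def fscale_def) (metis add.right_neutral)
  moreover have R0: "?R = {0}" unfolding rels by simp
  ultimately have "fspan (?V \<union> ?R) = ?V"
    by (simp add: fvs.span_eq_iff fvs.subspace_0 insert_absorb)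
  then have zV: "z1 \<in> ?V" "z2 \<in> ?V" using z by simp_all
  have fd: "finite (words_deg M 1 s t j k)"
    by (rule finite_subset[OF _ finite_words[OF fin, of 1]]) (auto simp: words_deg_def)
  have cyc: "(\<Sum>w\<in>words_deg M 1 s t j k. v w * dword M w c) = 0" if "v \<in> ?V" "dlin M 1 v \<in> ?R" for v c
  proof -
    have "(\<Sum>w\<in>words_deg M 1 s t j k. v w * dword M w c) = lin_ext (dword M) v c"
      by (rule lin_ext_superset[OF fd, symmetric]) (use that in auto)
    also have "\<dots> = dlin M 1 v c" using that by (simp add: dlin_lin_ext[OF fin])
    finally show ?thesis using that(2) R0 by simp
  qed
  have "\<exists>c1 c2 y. (c1 \<noteq> 0 \<or> c2 \<noteq> 0) \<and> (\<forall>x. c1 * z1 x + c2 * z2 x = (\<Sum>u\<in>{}. y u * dword M u x))"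
    by (rule morse[where X = "words_deg M 1 s t j k" and m = m and wt = "\<lambda>_. 0 :: nat"])
      (use fd m_nz m_fun m_tri crit cyc z zV in auto)
  then obtain c1 c2 where c: "c1 \<noteq> 0 \<or> c2 \<noteq> 0" and "\<And>x. c1 * z1 x + c2 * z2 x = 0" by auto
  then have "fscale c1 z1 + fscale c2 z2 = 0" by (simp add: fscale_def fun_eq_iff)
  then show "\<exists>c1 c2. (c1 \<noteq> 0 \<or> c2 \<noteq> 0) \<and> fscale c1 z1 + fscale c2 z2 \<in> fspan (dlin M 1 ` Vsp M 1 \<union> ?R)"
    using c fvs.span_zero by metis
qed

text \<open>The graded piece itself has dimension at most one: k gives the exponent of x, j + k that
  of xi, and t the right idempotent.\<close>

lemma hdim_psi: "hdim p (psiM p :: (pb,'f::field) bimod) 1 s t j k \<le> 1"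
proof (rule hdim_one[where m = "\<lambda>_ _. False"])
  show "finite (bas (psiM p :: (pb,'f) bimod))" by (simp add: psiM_def finite_PB)
  fix x x' assume x: "x \<in> words_deg (psiM p :: (pb,'f) bimod) 1 s t j k" "x' \<in> words_deg (psiM p :: (pb,'f) bimod) 1 s t j k"
  then obtain \<alpha> \<alpha>' where "x = [\<alpha>]" "x' = [\<alpha>']"
    by (auto simp: words_deg_def words_def length_Suc_conv)
  with x show "x = x'"
    by (cases \<alpha>; cases \<alpha>') (auto simp: words_deg_def psiM_def pb_j_def pb_k_def pb_ri_def)
qed (simp_all add: psiM_def)

text \<open>The coefficient of gamma^* in xi beta^* tests gamma xi = beta, so xi strips a xi from
  the right end of beta and lowers its right index.\<close>

lemma lmul_dual_xi:
  assumes "(r,a,b) \<in> PB p"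
  shows "lmul_dual p (xi_el p :: pb \<Rightarrow> 'f::field) (r,a,b) = (if b = 0 then 0 else ind (r - 1,a,b - 1))"
proof
  fix \<gamma> :: pb
  obtain r' a' b' where g: "\<gamma> = (r',a',b')" by (cases \<gamma>)
  have "(\<Sum>\<psi>\<in>PB p. xi_el p \<psi> * (if pb_mult \<gamma> \<psi> = Some (r,a,b) then 1 else 0 :: 'f)) =
    (if (r,0,1) \<in> PB p then xi_el p (r,0,1) * (if pb_mult \<gamma> (r,0,1) = Some (r,a,b) then 1 else 0) else 0)"
    by (rule sum_one[OF finite_PB]) (auto simp: xi_el_def g pb_mult_def split: if_splits)
  also have "\<dots> = (if \<gamma> = (r - 1, a, b - 1) \<and> b \<noteq> 0 then 1 else 0)"
    using assms by (auto simp: xi_el_def g pb_mult_def PB_def)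
  finally have sum: "(\<Sum>\<psi>\<in>PB p. xi_el p \<psi> * (if pb_mult \<gamma> \<psi> = Some (r,a,b) then 1 else 0)) = (if \<gamma> = (r - 1, a, b - 1) \<and> b \<noteq> 0 then 1 else 0 :: 'f)" .
  show "lmul_dual p (xi_el p :: pb \<Rightarrow> 'f) (r,a,b) \<gamma> = (if b = 0 then 0 else ind (r - 1,a,b - 1)) \<gamma>"
    using assms unfolding lmul_dual_def sum by (auto simp: ind_def PB_def)
qed

lemma lmul_dual_x:
  assumes "(r,a,b) \<in> PB p"
  shows "lmul_dual p (x_el p :: pb \<Rightarrow> 'f::field) (r,a,b) = (if a = 0 then 0 else ind (r - 1,a - 1,b))"
proof
  fix \<gamma> :: pb
  obtain r' a' b' where g: "\<gamma> = (r',a',b')" by (cases \<gamma>)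
  have "(\<Sum>\<psi>\<in>PB p. x_el p \<psi> * (if pb_mult \<gamma> \<psi> = Some (r,a,b) then 1 else 0 :: 'f)) =
    (if (r,1,0) \<in> PB p then x_el p (r,1,0) * (if pb_mult \<gamma> (r,1,0) = Some (r,a,b) then 1 else 0) else 0)"
    by (rule sum_one[OF finite_PB]) (auto simp: x_el_def g pb_mult_def split: if_splits)
  also have "\<dots> = (if \<gamma> = (r - 1, a - 1, b) \<and> a \<noteq> 0 then 1 else 0)"
    using assms by (auto simp: x_el_def g pb_mult_def PB_def)
  finally have sum: "(\<Sum>\<psi>\<in>PB p. x_el p \<psi> * (if pb_mult \<gamma> \<psi> = Some (r,a,b) then 1 else 0)) = (if \<gamma> = (r - 1, a - 1, b) \<and> a \<noteq> 0 then 1 else 0 :: 'f)" .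
  show "lmul_dual p (x_el p :: pb \<Rightarrow> 'f) (r,a,b) \<gamma> = (if a = 0 then 0 else ind (r - 1,a - 1,b)) \<gamma>"
    using assms unfolding lmul_dual_def sum by (auto simp: ind_def PB_def)
qed

lemma dword_single: "dword M [m] v = (if length v = 1 then dg M m (v ! 0) else 0)"
  by (auto simp: dword_def subst_at_def fscale_def ksign_def)

lemma rmul_PB: "\<alpha> \<in> PB p \<Longrightarrow> rmul p \<alpha> c \<gamma> \<noteq> 0 \<Longrightarrow> \<gamma> \<in> PB p"
  unfolding rmul_def by (auto elim!: sum.not_neutral_contains_not_neutral split: if_splits intro: pb_mult_PB)

lemma malt_dg_bas:
  assumes "m \<in> bas (maltM p :: (pb \<times> pb,'f::field) bimod)" "dg (maltM p :: (pb \<times> pb,'f) bimod) m m' \<noteq> 0"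
  shows "m' \<in> bas (maltM p :: (pb \<times> pb,'f) bimod)"
proof -
  obtain \<alpha> \<beta> \<gamma> \<delta> where m: "m = (\<alpha>,\<beta>)" "m' = (\<gamma>,\<delta>)" by (cases m; cases m')
  have "\<alpha> \<in> PB p" using assms(1) by (simp add: m maltM_def)
  have "pb_ri \<gamma> + pb_ri \<delta> = p + 1" and
    "rmul p \<alpha> (x_el p) \<gamma> * lmul_dual p (xi_el p) \<beta> \<delta> \<noteq> (0 :: 'f) \<or>
     rmul p \<alpha> (xi_el p) \<gamma> * lmul_dual p (x_el p) \<beta> \<delta> \<noteq> (0 :: 'f)"
    using assms(2) by (auto simp: m maltM_def split: if_splits)
  note nz = this
  from nz(2) have "\<exists>c. rmul p \<alpha> c \<gamma> \<noteq> (0 :: 'f)" by auto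
  then have "\<gamma> \<in> PB p" by (elim exE) (rule rmul_PB[OF \<open>\<alpha> \<in> PB p\<close>])
  moreover from nz(2) have "\<delta> \<in> PB p" by (auto simp: lmul_dual_def split: if_splits)
  ultimately show ?thesis using nz(1) by (simp add: m maltM_def)
qed

text \<open>From c > 0 follows q >= 2, hence r < p and xi fits behind x^a. The other summand
  vanishes because xi kills (x^c)^*.\<close>

lemma malt_dg:
  assumes "((r,a,0),(q,c,0)) \<in> bas (maltM p :: (pb \<times> pb,'f::field) bimod)" "c \<noteq> 0"
  shows "dg (maltM p :: (pb \<times> pb,'f) bimod) ((r,a,0),(q,c,0)) m \<noteq> 0 \<longleftrightarrow> m = ((Suc r,a,1),(q - 1,c - 1,0))"
proof -
  obtain \<gamma> \<delta> where m: "m = (\<gamma>,\<delta>)" by (cases m)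
  have PB: "(r,a,0) \<in> PB p" "(q,c,0) \<in> PB p" "r + q = p + 1" using assms(1) by (simp_all add: maltM_def pb_ri_def)
  have "r < p" "2 \<le> q" using PB assms(2) by (auto simp: PB_def)
  then show ?thesis
    using PB(3) by (auto simp: m maltM_def rmul_x[OF PB(1)] rmul_xi[OF PB(1)] lmul_dual_x[OF PB(2)] lmul_dual_xi[OF PB(2)]
      ind_eq_0 pb_ri_def assms(2))
qed

text \<open>A degree contains at most two basis elements, and then they are
  x^a (x) (x^c)^* and x^(a-1) xi (x) (x^(c-1) xi)^* with c > 0, where d is nonzero on the first one.\<close>

lemma hdim_malt: "hdim p (maltM p :: (pb \<times> pb,'f::field) bimod) 1 s t j k \<le> 1"
proof (rule hdim_one)
  let ?M = "maltM p :: (pb \<times> pb,'f) bimod"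
  let ?m = "\<lambda>u v. \<exists>r a q c. u = [((r,a,0),(q,c,0))] \<and> ((r,a,0),(q,c,0)) \<in> bas ?M \<and> c \<noteq> 0 \<and>
    v = [((Suc r,a,1),(q - 1,c - 1,0))]"
  show "finite (bas ?M)"
    by (rule finite_subset[of _ "PB p \<times> PB p"]) (auto simp: maltM_def finite_PB)
  show "m' \<in> bas ?M" if "m \<in> bas ?M" "dg ?M m m' \<noteq> 0" for m m'
    by (rule malt_dg_bas[OF that])
  show "dword ?M u v \<noteq> 0" if uv: "?m u v" for u v
  proof -
    obtain r a q c where u: "u = [((r,a,0),(q,c,0))]" "((r,a,0),(q,c,0)) \<in> bas ?M" "c \<noteq> 0"
      "v = [((Suc r,a,1),(q - 1,c - 1,0))]" using uv by blast
    show ?thesis using malt_dg[OF u(2,3), of "((Suc r,a,1),(q - 1,c - 1,0))"] by (simp add: dword_single u(1,4))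
  qed
  show "v = v'" if "?m u v" "?m u v'" for u v v' using that by auto
  show "u = u'" if u: "?m u v" "?m u' v'" and nz: "dword ?M u v' \<noteq> 0" for u v u' v'
  proof -
    obtain r a q c where 1: "u = [((r,a,0),(q,c,0))]" "((r,a,0),(q,c,0)) \<in> bas ?M" "c \<noteq> 0" using u(1) by blast
    obtain r' a' q' c' where 2: "u' = [((r',a',0),(q',c',0))]" "((r',a',0),(q',c',0)) \<in> bas ?M" "c' \<noteq> 0"
      "v' = [((Suc r',a',1),(q' - 1,c' - 1,0))]" using u(2) by blast
    have "((Suc r',a',1),(q' - 1,c' - 1,0)) = ((Suc r,a,1 :: nat),(q - 1,c - 1,0 :: nat))"
      using nz malt_dg[OF 1(2,3)] by (simp add: dword_single 1(1) 2(4))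
    moreover have "1 \<le> q" "1 \<le> q'" using 1(2) 2(2) by (auto simp: maltM_def PB_def)
    ultimately show ?thesis using 1 2 by auto
  qed
  show "x = x'" if x: "x \<in> words_deg ?M 1 s t j k" "x' \<in> words_deg ?M 1 s t j k"
    "\<nexists>v. ?m x v" "\<nexists>v. ?m x' v" for x x'
  proof -
    have *: "\<exists>r a b q c e. y = [((r,a,b),(q,c,e))] \<and> b \<le> 1 \<and> e \<le> 1 \<and> r = s + a + b \<and> q = t + c + e \<and> r + q = p + 1 \<and>
      int b - int a - (int e - int c) + 1 = j \<and> int a - int c = k \<and> (b = 0 \<longrightarrow> e = 0 \<longrightarrow> c = 0)"
      if y: "y \<in> words_deg ?M 1 s t j k" "\<nexists>v. ?m y v" for y
    proof -
      obtain r a b q c e where ye: "y = [((r,a,b),(q,c,e))]"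
        using y(1) by (auto simp: words_deg_def words_def length_Suc_conv)
      have b: "((r,a,b),(q,c,e)) \<in> bas ?M" using y(1) by (simp add: ye words_deg_def words_def)
      then have "b = 0 \<longrightarrow> e = 0 \<longrightarrow> c = 0" using y(2) by (auto simp: ye)
      moreover have "r - a - b = s" "q - c - e = t" "int b - int a - (int e - int c) + 1 = j" "int a - int c = k"
        using y(1) by (simp_all add: ye words_deg_def maltM_def pb_li_def pb_ri_def pb_j_def pb_k_def)
      moreover have "b \<le> 1" "e \<le> 1" "a + b + 1 \<le> r" "c + e + 1 \<le> q" "r + q = p + 1"
        using b by (simp_all add: maltM_def PB_def pb_ri_def)
      ultimately show ?thesis using ye by auto
    qed
    obtain r a b q c e where 1: "x = [((r,a,b),(q,c,e))]" "b \<le> 1" "e \<le> 1" "r = s + a + b" "q = t + c + e" "r + q = p + 1"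
      "int b - int a - (int e - int c) + 1 = j" "int a - int c = k" "b = 0 \<longrightarrow> e = 0 \<longrightarrow> c = 0"
      using *[OF x(1,3)] by (elim exE conjE)
    obtain r' a' b' q' c' e' where 2: "x' = [((r',a',b'),(q',c',e'))]" "b' \<le> 1" "e' \<le> 1" "r' = s + a' + b'" "q' = t + c' + e'" "r' + q' = p + 1"
      "int b' - int a' - (int e' - int c') + 1 = j" "int a' - int c' = k" "b' = 0 \<longrightarrow> e' = 0 \<longrightarrow> c' = 0"
      using *[OF x(2,4)] by (elim exE conjE)
    have eq: "int b - int e = int b' - int e'" "int a - int c = int a' - int c'" "int a + int b + int c + int e = int a' + int b' + int c' + int e'"
      using 1(4-8) 2(4-8) by linarith+
    have b: "b = 0 \<or> b = 1" "e = 0 \<or> e = 1" "b' = 0 \<or> b' = 1" "e' = 0 \<or> e' = 1" using 1(2,3) 2(2,3) by linarith+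
    \<comment> \<open>If (b,e) were (0,0) for one word and (1,1) for the other, the first would have
      its exponents a and c larger by one. So its c would be positive, making it a source, which is
      excluded.\<close>
    have "int b = int b' \<and> int e = int e' \<and> int a = int a' \<and> int c = int c'"
      using b eq 1(9) 2(9) by (elim disjE; simp; linarith)
    then have "b = b' \<and> e = e' \<and> a = a' \<and> c = c'" by simp
    then show ?thesis using 1 2 by simp
  qed
qed

theorem theorem44:
  fixes p :: nat
  assumes "CHAR('f::alg_closed_field) = p" and "p > 0"
  shows "\<forall>i j k s t. i \<le> 1 \<and> 1 \<le> s \<and> s \<le> p \<and> 1 \<le> t \<and> t \<le> p \<longrightarrow>
           upsilon_dim TYPE('f) p i j k s t \<le> 1"
proof (intro allI impI, elim conjE)
  fix i j k :: int and s t :: nat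
  assume i: "i \<le> 1" and s: "s \<le> p"
  \<comment> \<open>A field of positive characteristic has prime characteristic; p >= 2 is what
    makes sigma(p) = 1 smaller than p.\<close>
  have "prime p" using assms prime_CHAR_semidom[where 'a = 'f] by simp
  then have p: "2 \<le> p" by (rule prime_ge_2_nat)
  consider "i = 0" | "i = 1" | "i < 0" using i by linarith
  then show "upsilon_dim TYPE('f) p i j k s t \<le> 1"
  proof cases
    case 1
    then show ?thesis using hdim_psi by (simp add: upsilon_dim_def)
  next
    case 2
    then show ?thesis using hdim_malt by (simp add: upsilon_dim_def)
  next
    case 3
    then have "1 \<le> nat (- i)" by linarith
    then show ?thesis using hdim_maltinv[OF p s] 3 by (simp add: upsilon_dim_def)
  qed
qed

end
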